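(* Let $\alpha>-1$, $0\le\gamma<2+\alpha$ and $1<p<\frac{2+\alpha}{\gamma}$ (with $\frac{2+\alpha}{\gamma}=\infty$ if $\gamma=0$), and let $q$ be defined by $\frac1q=\frac1p-\frac{\gamma}{2+\alpha}$. There is a constant $C$ depending only on $p,\alpha,\gamma$ such that for every weight $\omega$ with $[\omega]_{\mathcal B_{p,q,\alpha}}<\infty$ and all $f$, $$\|\omega\,\mathcal M_{\alpha,\gamma}f\|_{q,\alpha}\le C([\omega]_{\mathcal B_{p,q,\alpha}})^{\frac{p'}{q}(1-\frac{\gamma}{2+\alpha})}\|\omega f\|_{p,\alpha}.$$ Moreover, the exponent $\frac{p'}{q}(1-\frac{\gamma}{2+\alpha})$ is sharp: for no smaller exponent $s$ does there exist a constant $C'$ with $\|\omega\,\mathcal M_{\alpha,\gamma}f\|_{q,\alpha}\le C'[\omega]_{\mathcal B_{p,q,\alpha}}^{s}\|\omega f\|_{p,\alpha}$ for all such $\omega$ and all $f$.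
   Context: $\mathcal H=\{x+iy:x\in\mathbb R,\ y>0\}$; for $\alpha>-1$, $dV_\alpha(x+iy)=y^\alpha dx\,dy$; $\|g\|_{r,\alpha}=(\int_{\mathcal H}|g|^rdV_\alpha)^{1/r}$; $p'$ is the conjugate exponent. A weight is a nonnegative locally integrable function. For an interval $I$, $Q_I=\{x+iy:x\in I,0<y<|I|\}$, $|Q_I|_\alpha=\int_{Q_I}dV_\alpha$. $\mathcal M_{\alpha,\gamma}f(z)=\sup\{|I|^{-(2+\alpha-\gamma)}\int_{Q_I}|f|dV_\alpha: I\subset\mathbb R\text{ interval}, z\in Q_I\}$, and $[\omega]_{\mathcal B_{p,q,\alpha}}=\sup_I\left(\frac1{|Q_I|_\alpha}\int_{Q_I}\omega^qdV_\alpha\right)\left(\frac1{|Q_I|_\alpha}\int_{Q_I}\omega^{-p'}dV_\alpha\right)^{q/p'}$, supremum over all intervals $I\subset\mathbb R$. *)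

theory Defs
  imports "HOL-Analysis.Analysis"
begin

definition UH :: "complex set" where
  "UH = {z. 0 < Im z}"

definition enpow :: "ennreal \<Rightarrow> real \<Rightarrow> ennreal" where
  "enpow x s =
    (if x = top then (if s > 0 then top else if s = 0 then 1 else 0)
     else if x = 0 then (if s > 0 then 0 else if s = 0 then 1 else top)
     else ennreal (enn2real x powr s))"

definition wint :: "real \<Rightarrow> complex set \<Rightarrow> (complex \<Rightarrow> ennreal) \<Rightarrow> ennreal" where
  "wint \<alpha> A g = (\<integral>\<^sup>+ z. indicator A z * ennreal (Im z powr \<alpha>) * g z \<partial>lborel)"

definition Lnorm :: "real \<Rightarrow> real \<Rightarrow> (complex \<Rightarrow> ennreal) \<Rightarrow> ennreal" where
  "Lnorm r \<alpha> g = enpow (wint \<alpha> UH (\<lambda>z. enpow (g z) r)) (1 / r)"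

definition Qbox :: "real \<Rightarrow> real \<Rightarrow> complex set" where
  "Qbox a b = {z. a \<le> Re z \<and> Re z \<le> b \<and> 0 < Im z \<and> Im z < b - a}"

definition Qmeas :: "real \<Rightarrow> real \<Rightarrow> real \<Rightarrow> ennreal" where
  "Qmeas \<alpha> a b = wint \<alpha> (Qbox a b) (\<lambda>_. 1)"

definition maxop :: "real \<Rightarrow> real \<Rightarrow> (complex \<Rightarrow> complex) \<Rightarrow> complex \<Rightarrow> ennreal" where
  "maxop \<alpha> \<gamma> f z =
    (SUP I \<in> {(a, b). a < b \<and> z \<in> Qbox a b}.
       ennreal ((snd I - fst I) powr (-(2 + \<alpha> - \<gamma>))) *
       wint \<alpha> (Qbox (fst I) (snd I)) (\<lambda>w. ennreal (norm (f w))))"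

definition conj_exp :: "real \<Rightarrow> real" where
  "conj_exp p = p / (p - 1)"

definition Bchar :: "real \<Rightarrow> real \<Rightarrow> real \<Rightarrow> (complex \<Rightarrow> real) \<Rightarrow> ennreal" where
  "Bchar p q \<alpha> \<omega> =
    (SUP I \<in> {(a, b). a < b}.
       (wint \<alpha> (Qbox (fst I) (snd I)) (\<lambda>z. enpow (ennreal (\<omega> z)) q) / Qmeas \<alpha> (fst I) (snd I)) *
       enpow (wint \<alpha> (Qbox (fst I) (snd I)) (\<lambda>z. enpow (ennreal (\<omega> z)) (- conj_exp p))
                / Qmeas \<alpha> (fst I) (snd I)) (q / conj_exp p))"

definition weight :: "(complex \<Rightarrow> real) \<Rightarrow> bool" where
  "weight \<omega> \<longleftrightarrow> (\<forall>z\<in>UH. 0 \<le> \<omega> z) \<and>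
     (\<forall>K. compact K \<and> K \<subseteq> UH \<longrightarrow> set_integrable lborel K \<omega>)"

end

theory Submission
  imports Defs
begin

text \<open>
  Upper bound. Put \<open>u = \<omega>^q\<close>, \<open>s = \<omega>^(-p')\<close>, \<open>\<theta> = \<gamma> / (2 + \<alpha>)\<close> and let \<open>\<kappa>\<close> be the exponent of the theorem.
  Every box \<open>Q_I\<close> lies in a comparable box of one of two dyadic grids. On a dyadic box \<open>Q\<close> of mass \<open>m\<close>,
  the characteristic and Hoelder's inequality bound \<open>m^(\<theta> - 1) \<integral>_Q |f|\<close> by a constant times
  \<open>[\<omega>]^\<kappa> \<parallel>\<omega> f\<parallel>_p^(p \<theta>) (m / u(Q) \<cdot> avg_{s,Q}(|f| / s)^(p / (q \<kappa>)))^\<kappa>\<close>, whose last factor is dominated by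
  \<open>M_u(M_s(|f| / s)^(p / (q \<kappa>)) / u)^\<kappa>\<close> with \<open>M_u\<close>, \<open>M_s\<close> the weighted dyadic maximal operators. These are
  bounded on \<open>L^(q \<kappa>)(u)\<close> and \<open>L^p(s)\<close> with norms independent of the weight, and \<open>u^(1 - q \<kappa>) = s\<close>.

  Sharpness. With \<open>|z| = max |Re z| |Im z|\<close> take \<open>\<omega> = |z|^((2 + \<alpha> - \<delta>) / p')\<close> and \<open>f = |z|^(\<delta> - 2 - \<alpha>)\<close> on
  \<open>|z| < 1\<close>. As \<open>\<delta>\<close> tends to 0, \<open>[\<omega>]\<close> is \<open>O(\<delta>^(-q / p'))\<close>, \<open>\<parallel>\<omega> f\<parallel>_p\<close> is \<open>O(\<delta>^(-1 / p))\<close>, and the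
  left-hand side is at least of order \<open>\<delta>^(-1 - 1 / q)\<close>.
\<close>

section \<open>Weighted maximal operators over laminar families\<close>

text \<open>The exponents are arranged so that the characteristic is paid for exactly once. Since
  \<kappa> q / p' = 1 - \<theta>, its power \<kappa> supplies precisely the factor (s(Q) / m)^(1 -
  \<theta>) of a box average; the s-average of |f| / s is split with exponents p \<theta> + p / q =
  1, Hoelder's inequality taking the first share and the maximal operators the second. Each maximal
  operator then acts in its own measure. As u and s have no uniform doubling constant, the maximal
  theorem is proved for arbitrary measures, using only that two sets of the family are nested or
  disjoint. No self-improvement of the weight class, which would bring in further powers of the
  characteristic, is used. For sharpness, an inequality with exponent s \<ge> 0 would force 1 + 1 /
  q \<le> s q / p' + 1 / p as \<delta> tends to 0, that is s q / p' \<ge> 1 - \<theta>. Both sides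
  have the same rate exactly at s = \<kappa>.\<close>

lemma enpow_ennreal: "0 < x \<or> (0 \<le> x \<and> 0 < s) \<Longrightarrow> enpow (ennreal x) s = ennreal (x powr s)"
  by (auto simp: enpow_def)

lemma enpow_zero [simp]: "0 < s \<Longrightarrow> enpow 0 s = 0"
  and enpow_top [simp]: "0 < s \<Longrightarrow> enpow top s = top"
  by (auto simp: enpow_def)

lemma enpow_one_right [simp]: "enpow x 1 = x"
  by (cases x) (auto simp: enpow_def)

lemma measurable_enpow [measurable]: "(\<lambda>x. enpow x s) \<in> borel_measurable borel"
  unfolding enpow_def by measurable

lemma enpow_mono: "0 < s \<Longrightarrow> x \<le> y \<Longrightarrow> enpow x s \<le> enpow y s"
  by (cases x; cases y) (auto simp: enpow_ennreal powr_mono2 top_unique)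

lemma enpow_mult: "0 < s \<Longrightarrow> enpow (x * y) s = enpow x s * enpow y s"
  by (cases x; cases y)
     (auto simp: enpow_ennreal powr_mult ennreal_mult[symmetric] ennreal_mult_top ennreal_top_mult)

lemma enpow_enpow: "0 < s \<Longrightarrow> 0 < t \<Longrightarrow> enpow (enpow x s) t = enpow x (s * t)"
  by (cases x) (auto simp: enpow_ennreal powr_powr)

lemma enpow_max_le:
  assumes "0 < s" shows "enpow (max x y) s \<le> enpow x s + enpow y s"
  by (cases "x \<le> y") (auto simp: max_def add_increasing add_increasing2)

section \<open>Maximal operators over nested families: weak type\<close>

text \<open>The one property of dyadic boxes that the maximal theorem uses; with it the constants do
  not see the measure.\<close>

definition laminar :: "'a set set \<Rightarrow> bool" where
  "laminar F \<longleftrightarrow> (\<forall>A\<in>F. \<forall>B\<in>F. A \<inter> B = {} \<or> A \<subseteq> B \<or> B \<subseteq> A)"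

text \<open>Division by infinite mass gives 0, and so does 0 / 0, so sets of zero or infinite mass
  contribute nothing. A point in no member gets the empty supremum 0.\<close>

definition lmax :: "'a measure \<Rightarrow> 'a set set \<Rightarrow> ('a \<Rightarrow> ennreal) \<Rightarrow> 'a \<Rightarrow> ennreal" where
  "lmax M F g x = (SUP A\<in>{A\<in>F. x \<in> A}. (\<integral>\<^sup>+y\<in>A. g y \<partial>M) / emeasure M A)"

lemma laminar_subset: "laminar F \<Longrightarrow> G \<subseteq> F \<Longrightarrow> laminar G"
  unfolding laminar_def by blast

lemma finite_laminar_emeasure_le:
  assumes "finite T" "laminar T" "T \<subseteq> sets M" "sets N = sets M"
    and "\<And>A. A \<in> T \<Longrightarrow> c * emeasure M A \<le> emeasure N A"
  shows "c * emeasure M (\<Union>T) \<le> emeasure N (\<Union>T)"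
  using assms
proof (induction T rule: finite_psubset_induct)
  case (psubset T)
  show ?case
  proof (cases "\<exists>A\<in>T. \<exists>B\<in>T. A \<noteq> B \<and> A \<subseteq> B")
    case True
    then obtain A B where AB: "A \<in> T" "B \<in> T" "A \<noteq> B" "A \<subseteq> B" by blast
    have "\<Union>(T - {A}) = \<Union>T" using AB by blast
    moreover have "c * emeasure M (\<Union>(T - {A})) \<le> emeasure N (\<Union>(T - {A}))"
      using psubset.prems AB by (intro psubset.IH) (auto intro: laminar_subset)
    ultimately show ?thesis by simp
  next
    case False
    then have dj: "disjoint T"
      using psubset.prems(1) unfolding laminar_def disjoint_def by blast
    have sum: "emeasure L (\<Union>T) = (\<Sum>A\<in>T. emeasure L A)" if "sets L = sets M" for L
      using sum_emeasure[of "\<lambda>A. A" T L] psubset dj that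
      by (auto simp: disjoint_family_on_def disjoint_def)
    have "c * emeasure M (\<Union>T) = (\<Sum>A\<in>T. c * emeasure M A)"
      by (simp add: sum sum_distrib_left)
    also have "\<dots> \<le> (\<Sum>A\<in>T. emeasure N A)" by (intro sum_mono psubset.prems)
    also have "\<dots> = emeasure N (\<Union>T)"
      using psubset.prems by (simp add: sum)
    finally show ?thesis .
  qed
qed

text \<open>Unions of finite subfamilies exhaust the whole union, and continuity from below replaces
  the selection of maximal sets.\<close>

lemma countable_laminar_emeasure_le:
  assumes "countable T" "laminar T" "T \<subseteq> sets M" "sets N = sets M"
    and le: "\<And>A. A \<in> T \<Longrightarrow> c * emeasure M A \<le> emeasure N A"
  shows "c * emeasure M (\<Union>T) \<le> emeasure N (\<Union>T)"
proof (cases "T = {}")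
  case False
  define A where "A n = \<Union>(from_nat_into T ` {..n})" for n :: nat
  have sub: "from_nat_into T ` {..n} \<subseteq> T" for n
    using from_nat_into[OF False] by auto
  have UA: "\<Union>T = (\<Union>n. A n)"
    unfolding A_def by (subst (1) range_from_nat_into[OF False assms(1), symmetric]) force
  have inc: "incseq A" unfolding A_def incseq_def by fastforce
  have Am: "A n \<in> sets M" for n unfolding A_def using sub[of n] assms(3) by (intro sets.finite_Union) auto
  have "c * emeasure M (\<Union>T) = c * (SUP n. emeasure M (A n))"
    unfolding UA using Am inc by (subst SUP_emeasure_incseq) auto
  also have "\<dots> = (SUP n. c * emeasure M (A n))"
    by (simp add: SUP_mult_left_ennreal)
  also have "\<dots> \<le> emeasure N (\<Union>T)"
  proof (rule SUP_least)
    fix n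
    have "c * emeasure M (A n) \<le> emeasure N (A n)"
      unfolding A_def using sub[of n] assms
      by (intro finite_laminar_emeasure_le) (auto intro: laminar_subset)
    also have "\<dots> \<le> emeasure N (\<Union>T)"
      using Am assms(4) by (intro emeasure_mono) (auto simp: UA)
    finally show "c * emeasure M (A n) \<le> emeasure N (\<Union>T)" .
  qed
  finally show ?thesis .
qed simp

text \<open>One large average puts its whole set above the level. This yields both measurability and
  a ready-made cover for the weak type.\<close>

lemma lmax_superlevel:
  assumes "F \<subseteq> sets M"
  shows "{x \<in> space M. c < lmax M F g x} = \<Union>{A\<in>F. c < (\<integral>\<^sup>+y\<in>A. g y \<partial>M) / emeasure M A}"
proof -
  have "A \<subseteq> space M" if "A \<in> F" for A using assms that sets.sets_into_space by blast
  then show ?thesis unfolding lmax_def less_SUP_iff by (intro set_eqI) (simp, blast)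
qed

lemma borel_measurable_lmax [measurable]:
  assumes "F \<subseteq> sets M" "countable F"
  shows "lmax M F g \<in> borel_measurable M"
proof (rule borel_measurableI_greater)
  fix c
  have "\<Union>{A\<in>F. c < (\<integral>\<^sup>+y\<in>A. g y \<partial>M) / emeasure M A} \<in> sets M"
    using assms by (intro sets.countable_Union countable_subset[OF _ assms(2)]) auto
  then show "{x \<in> space M. c < lmax M F g x} \<in> sets M"
    using lmax_superlevel[OF assms(1)] by metis
qed

text \<open>Where g \<le> c nothing more than c is lost, so an average above 2 c forces the part of
  g above c to have average at least c. Keeping only that part on the right is what allows the
  levels to be summed afterwards.\<close>

lemma lmax_weak_type:
  fixes c :: real
  assumes F: "F \<subseteq> sets M" "countable F" "laminar F" and g [measurable]: "g \<in> borel_measurable M"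
    and c: "0 < c"
  shows "ennreal c * emeasure M {x \<in> space M. ennreal (2 * c) < lmax M F g x}
           \<le> (\<integral>\<^sup>+x. g x * indicator {x. ennreal c < g x} x \<partial>M)"
proof -
  define N where "N = density M (\<lambda>x. g x * indicator {x. ennreal c < g x} x)"
  define T where "T = {A\<in>F. ennreal (2*c) < (\<integral>\<^sup>+y\<in>A. g y \<partial>M) / emeasure M A}"
  have T: "T \<subseteq> F" by (auto simp: T_def)
  have le: "ennreal c * emeasure M A \<le> emeasure N A" if "A \<in> T" for A
  proof -
    have A [measurable]: "A \<in> sets M" using that F by (auto simp: T_def)
    have *: "ennreal (2*c) < (\<integral>\<^sup>+y\<in>A. g y \<partial>M) / emeasure M A" using that by (auto simp: T_def)
    \<comment> \<open>Infinite mass would make the quotient 0, which is not above 2 c.\<close>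
    then have fin: "emeasure M A < top"
      by (metis ennreal_divide_top less_top not_less_zero)
    have nz: "emeasure M A \<noteq> 0"
    proof
      assume "emeasure M A = 0"
      then have "A \<in> null_sets M" by auto
      then have "(\<integral>\<^sup>+y\<in>A. g y \<partial>M) = 0" by (rule nn_integral_null_set)
      then show False using * by simp
    qed
    have "ennreal (2*c) * emeasure M A \<le> (\<integral>\<^sup>+y\<in>A. g y \<partial>M) / emeasure M A * emeasure M A"
      using * by (intro mult_right_mono) auto
    also have "\<dots> = (\<integral>\<^sup>+y\<in>A. g y \<partial>M)"
      using nz fin by (simp add: ennreal_divide_times ennreal_mult_divide_eq less_top)
    also have "\<dots> \<le> (\<integral>\<^sup>+y. g y * indicator {x. ennreal c < g x} y * indicator A y + ennreal c * indicator A y \<partial>M)"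
      by (intro nn_integral_mono) (auto split: split_indicator)
    also have "\<dots> = emeasure N A + ennreal c * emeasure M A"
      unfolding N_def by (subst nn_integral_add) (auto simp: emeasure_density nn_integral_cmult)
    finally have "ennreal c * emeasure M A + ennreal c * emeasure M A \<le> ennreal c * emeasure M A + emeasure N A"
      using ennreal_plus[of c c] c by (simp add: distrib_right add.commute del: ennreal_plus)
    \<comment> \<open>Finiteness permits cancelling this summand in \<open>ennreal\<close>.\<close>
    moreover have "ennreal c * emeasure M A < top" using fin by (simp add: ennreal_mult_less_top)
    ultimately show ?thesis
      by (auto simp: ennreal_add_left_cancel_le)
  qed
  have "ennreal c * emeasure M (\<Union>T) \<le> emeasure N (\<Union>T)"
    using F T le by (intro countable_laminar_emeasure_le)
       (auto simp: N_def intro: laminar_subset countable_subset)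
  also have "\<dots> \<le> emeasure N (space N)"
    by (intro emeasure_space)
  also have "\<dots> = (\<integral>\<^sup>+x. g x * indicator {x. ennreal c < g x} x \<partial>M)"
    unfolding N_def by (simp add: emeasure_density space_density cong: nn_integral_cong)
  finally show ?thesis
    unfolding lmax_superlevel[OF F(1)] T_def .
qed

section \<open>Strong type by summation over dyadic levels\<close>

lemma enpow_add: "0 < s \<Longrightarrow> 0 < t \<Longrightarrow> enpow x (s + t) = enpow x s * enpow x t"
  by (cases x) (auto simp: enpow_ennreal powr_add ennreal_mult' ennreal_top_mult)

lemma dyadic_level:
  fixes t :: real
  assumes "0 < t"
  obtains K :: int where "{k::int. 2 powr k < t} = {..K}" "2 powr K < t" "t \<le> 2 * 2 powr K"
proof
  \<comment> \<open>The inequality 2^k < t is strict: for t = 2^n the last level is n - 1, hence the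
    ceiling minus one and not the floor.\<close>
  define K where "K = \<lceil>log 2 t\<rceil> - 1"
  have iff: "2 powr real_of_int k < t \<longleftrightarrow> k \<le> K" for k
    using assms by (simp add: less_log_iff[symmetric] K_def less_ceiling_iff[symmetric])
  then show "{k::int. 2 powr k < t} = {..K}" by auto
  show "2 powr real_of_int K < t" using iff by simp
  have "\<not> 2 powr real_of_int (K + 1) < t" using iff[of "K+1"] by simp
  then show "t \<le> 2 * 2 powr real_of_int K" by (simp add: powr_add mult.commute)
qed

lemma two_powr_neg_less_one: "0 < r \<Longrightarrow> 2 powr (- r) < (1::real)"
  using powr_less_mono[of "- r" 0 2] by simp

text \<open>A discrete layer-cake formula: the levels below t form a geometric series governed by
  its top term. The sum is written as an integral over \<open>count_space\<close> so that it can be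
  exchanged with the integral over the space.\<close>

lemma dyadic_sum_le:
  fixes t :: ennreal
  assumes r: "0 < r"
  shows "(\<integral>\<^sup>+k. ennreal (2 powr (real_of_int k * r)) * indicator {k::int. ennreal (2 powr real_of_int k) < t} k \<partial>count_space UNIV)
          \<le> ennreal (1 / (1 - 2 powr (- r))) * enpow t r"
proof (cases t)
  case top
  have "2 powr (- r) < (1::real)" using r by (rule two_powr_neg_less_one)
  then show ?thesis using r top by (simp add: ennreal_mult_top)
next
  case (real x)
  show ?thesis
  proof (cases "x = 0")
    case True
    then show ?thesis using real by simp
  next
    case False
    with real have "0 < x" by simp
    then obtain K :: int where K: "{k::int. 2 powr k < x} = {..K}" "2 powr K < x" "x \<le> 2 * 2 powr K"
      by (rule dyadic_level)
    define c :: real where "c = 2 powr (- r)"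
    have c: "0 \<le> c" "c < 1" using two_powr_neg_less_one[OF r] by (auto simp: c_def)
    have "{k::int. ennreal (2 powr real_of_int k) < t} = {..K}"
      using K(1) real by (auto simp: ennreal_less_iff)
    then have "(\<integral>\<^sup>+k. ennreal (2 powr (real_of_int k * r)) * indicator {k::int. ennreal (2 powr real_of_int k) < t} k \<partial>count_space UNIV)
        = (\<integral>\<^sup>+k. ennreal (2 powr (real_of_int k * r)) \<partial>count_space {..K})"
      by (simp add: nn_integral_count_space_indicator)
    \<comment> \<open>Counting down from the top level K gives a geometric series of ratio
      2^(-r).\<close>
    also have "\<dots> = (\<integral>\<^sup>+n. ennreal (2 powr (real_of_int (K - int n) * r)) \<partial>count_space UNIV)"
    proof (rule nn_integral_bij_count_space[symmetric])
      show "bij_betw (\<lambda>n. K - int n) UNIV {..K}"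
        by (rule bij_betwI[where g="\<lambda>k. nat (K - k)"]) auto
    qed
    also have "\<dots> = (\<Sum>n. ennreal (2 powr (real_of_int (K - int n) * r)))"
      by (rule nn_integral_count_space_nat)
    also have "(\<lambda>n. 2 powr (real_of_int (K - int n) * r)) = (\<lambda>n. 2 powr (real_of_int K * r) * c ^ n)"
      by (auto simp: fun_eq_iff c_def powr_realpow[symmetric] powr_powr powr_add[symmetric] algebra_simps)
    then have "(\<Sum>n. ennreal (2 powr (real_of_int (K - int n) * r))) = (\<Sum>n. ennreal (2 powr (real_of_int K * r) * c ^ n))"
      by metis
    also have "\<dots> = ennreal (2 powr (real_of_int K * r) * (1 / (1 - c)))"
      using c by (intro suminf_ennreal_eq sums_mult geometric_sums) auto
    also have "\<dots> \<le> ennreal (x powr r * (1 / (1 - c)))"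
    proof (intro ennreal_leI mult_right_mono)
      show "2 powr (real_of_int K * r) \<le> x powr r"
        using powr_mono2[of r "2 powr K" x] K(2) r by (simp add: powr_powr)
    qed (use c in auto)
    also have "\<dots> = ennreal (1 / (1 - c)) * enpow t r"
      using real r c by (simp add: enpow_ennreal ennreal_mult[symmetric] mult.commute)
    finally show ?thesis by (simp add: c_def)
  qed
qed

text \<open>For finite t > 0 the top level alone suffices, because t \<le> 2 * 2^K. For infinite t
  every level k \<ge> 0 contributes at least 1 and the sum diverges.\<close>

lemma dyadic_sum_ge:
  fixes t :: ennreal
  assumes r: "0 < r"
  shows "enpow t r \<le> ennreal (2 powr r) *
    (\<integral>\<^sup>+k. ennreal (2 powr (real_of_int k * r)) * indicator {k::int. ennreal (2 powr real_of_int k) < t} k \<partial>count_space UNIV)"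
    (is "_ \<le> _ * ?S t")
proof (cases t)
  case top
  have "emeasure (count_space UNIV) {0::int..} = (\<integral>\<^sup>+k. indicator {0::int..} k \<partial>count_space UNIV)"
    by simp
  also have "\<dots> \<le> ?S t"
    using r top by (intro nn_integral_mono) (auto split: split_indicator simp: ge_one_powr_ge_zero)
  finally have "?S t = top"
    by (simp add: emeasure_count_space_infinite infinite_Ici top_unique)
  then show ?thesis by (simp add: ennreal_mult_top)
next
  case (real x)
  show ?thesis
  proof (cases "x = 0")
    case True
    then show ?thesis using real r by simp
  next
    case False
    with real have "0 < x" by simp
    then obtain K :: int where K: "{k::int. 2 powr k < x} = {..K}" "2 powr K < x" "x \<le> 2 * 2 powr K"
      by (rule dyadic_level)
    have "x powr r \<le> (2 * 2 powr K) powr r"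
      using K real r by (intro powr_mono2) auto
    also have "\<dots> = 2 powr r * 2 powr (real_of_int K * r)" by (simp add: powr_mult powr_powr)
    finally have "enpow t r \<le> ennreal (2 powr r) * ennreal (2 powr (real_of_int K * r))"
      using real r by (simp add: enpow_ennreal ennreal_mult[symmetric] ennreal_leI)
    also have "ennreal (2 powr (real_of_int K * r)) \<le> (\<integral>\<^sup>+k. ennreal (2 powr (real_of_int K * r)) * indicator {K} k \<partial>count_space UNIV)"
      by simp
    also have "\<dots> \<le> ?S t"
      using K(2) real by (intro nn_integral_mono) (auto split: split_indicator simp: ennreal_less_iff)
    finally show ?thesis by (simp add: mult_left_mono)
  qed
qed

text \<open>The product of 2^r (lower level sum), 2 (weak type at half the level), 2^(r - 1) (level
  sum for 2 g) and the geometric factor 1 / (1 - 2^(1 - r)). It depends on r alone, so in a weighted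
  measure it hides no power of the characteristic.\<close>

definition lmax_const :: "real \<Rightarrow> real" where
  "lmax_const r = 2 powr (2 * r) / (1 - 2 powr (1 - r))"

lemma lmax_const_pos: "1 < r \<Longrightarrow> 0 < lmax_const r"
  using two_powr_neg_less_one[of "r - 1"] by (simp add: lmax_const_def)

text \<open>Marcinkiewicz interpolation with levels 2^k in place of a continuous parameter: the
  truncated weak type is summed over k and the sum moved inside the integral. The series has
  exponent r - 1 and therefore needs r > 1.\<close>

theorem lmax_strong_type:
  assumes F: "F \<subseteq> sets M" "countable F" "laminar F" and g [measurable]: "g \<in> borel_measurable M"
    and r: "1 < r"
  shows "(\<integral>\<^sup>+x. enpow (lmax M F g x) r \<partial>M) \<le> ennreal (lmax_const r) * (\<integral>\<^sup>+x. enpow (g x) r \<partial>M)"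
proof -
  note borel_measurable_lmax[OF F(1,2), measurable]
  have term_le: "ennreal (2 powr (real_of_int k * r)) * emeasure M {x \<in> space M. ennreal (2 powr real_of_int k) < lmax M F g x}
      \<le> 2 * (\<integral>\<^sup>+x. ennreal (2 powr (real_of_int k * (r - 1))) * (g x * indicator {k::int. ennreal (2 powr real_of_int k) < 2 * g x} k) \<partial>M)"
    for k :: int
  proof -
    \<comment> \<open>Half the level, because the weak type compares level 2 c of the maximal
      function with level c of g.\<close>
    define c :: real where "c = 2 powr k / 2"
    have c: "0 < c" "2 * c = 2 powr real_of_int k" by (auto simp: c_def)
    have iff: "ennreal c < y \<longleftrightarrow> ennreal (2 powr real_of_int k) < 2 * y" for y
      using c by (cases y) (auto simp: ennreal_less_iff ennreal_mult_top  simp flip: ennreal_numeral ennreal_mult)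
    have p: "2 powr (real_of_int k * r) = 2 * 2 powr (real_of_int k * (r - 1)) * c"
      by (simp add: c_def powr_add[symmetric] algebra_simps)
    have "ennreal (2 powr (real_of_int k * r)) * emeasure M {x \<in> space M. ennreal (2 powr real_of_int k) < lmax M F g x}
      = ennreal (2 * 2 powr (real_of_int k * (r - 1))) * (ennreal c * emeasure M {x \<in> space M. ennreal (2 * c) < lmax M F g x})"
      unfolding p using c by (simp add: ennreal_mult mult.assoc)
    also have "\<dots> \<le> ennreal (2 * 2 powr (real_of_int k * (r - 1))) * (\<integral>\<^sup>+x. g x * indicator {x. ennreal c < g x} x \<partial>M)"
      by (intro mult_left_mono lmax_weak_type F c g) auto
    also have "\<dots> = 2 * (\<integral>\<^sup>+x. ennreal (2 powr (real_of_int k * (r - 1))) * (g x * indicator {x. ennreal c < g x} x) \<partial>M)"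
      by (subst nn_integral_cmult) (auto simp: ennreal_mult mult.assoc)
    also have "(\<integral>\<^sup>+x. ennreal (2 powr (real_of_int k * (r - 1))) * (g x * indicator {x. ennreal c < g x} x) \<partial>M)
      = (\<integral>\<^sup>+x. ennreal (2 powr (real_of_int k * (r - 1))) * (g x * indicator {k::int. ennreal (2 powr real_of_int k) < 2 * g x} k) \<partial>M)"
      by (intro nn_integral_cong) (auto simp: iff split: split_indicator)
    finally show ?thesis .
  qed
  define a :: ennreal where "a = 2 * ennreal (2 powr r)"
  have c: "2 powr (1 - r) < 1" using two_powr_neg_less_one[of "r - 1"] r by simp
  have "(\<integral>\<^sup>+x. enpow (lmax M F g x) r \<partial>M)
    \<le> (\<integral>\<^sup>+x. ennreal (2 powr r) * (\<integral>\<^sup>+k. ennreal (2 powr (real_of_int k * r)) *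
          indicator {k::int. ennreal (2 powr real_of_int k) < lmax M F g x} k \<partial>count_space UNIV) \<partial>M)"
    using r by (intro nn_integral_mono dyadic_sum_ge) auto
  also have "\<dots> = (\<integral>\<^sup>+x. (\<integral>\<^sup>+k. ennreal (2 powr r) * (ennreal (2 powr (real_of_int k * r)) *
          indicator {x\<in>space M. ennreal (2 powr real_of_int k) < lmax M F g x} x) \<partial>count_space UNIV) \<partial>M)"
    by (subst nn_integral_cmult[symmetric]) (auto simp: indicator_def cong: nn_integral_cong)
  also have "\<dots> = (\<integral>\<^sup>+k. ennreal (2 powr r) * (ennreal (2 powr (real_of_int k * r)) *
      emeasure M {x\<in>space M. ennreal (2 powr real_of_int k) < lmax M F g x}) \<partial>count_space UNIV)"
    by (subst nn_integral_count_space_nn_integral) (auto simp: nn_integral_cmult)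
  also have "\<dots> \<le> (\<integral>\<^sup>+k. ennreal (2 powr r) * (2 * (\<integral>\<^sup>+x. ennreal (2 powr (real_of_int k * (r - 1))) *
      (g x * indicator {k::int. ennreal (2 powr real_of_int k) < 2 * g x} k) \<partial>M)) \<partial>count_space UNIV)"
    by (intro nn_integral_mono mult_left_mono term_le) auto
  also have "\<dots> = (\<integral>\<^sup>+k. (\<integral>\<^sup>+x. a * (ennreal (2 powr (real_of_int k * (r - 1))) *
      (g x * indicator {k::int. ennreal (2 powr real_of_int k) < 2 * g x} k)) \<partial>M) \<partial>count_space UNIV)"
    unfolding a_def by (subst nn_integral_cmult) (auto simp: indicator_def ac_simps)
  also have "\<dots> = (\<integral>\<^sup>+x. (\<integral>\<^sup>+k. a * (ennreal (2 powr (real_of_int k * (r - 1))) *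
      (g x * indicator {k::int. ennreal (2 powr real_of_int k) < 2 * g x} k)) \<partial>count_space UNIV) \<partial>M)"
    by (subst nn_integral_count_space_nn_integral) (auto simp: indicator_def)
  also have "\<dots> = (\<integral>\<^sup>+x. a * (g x * (\<integral>\<^sup>+k. ennreal (2 powr (real_of_int k * (r - 1))) *
      indicator {k::int. ennreal (2 powr real_of_int k) < 2 * g x} k \<partial>count_space UNIV)) \<partial>M)"
    by (simp add: nn_integral_cmult[symmetric] ac_simps)
  \<comment> \<open>Only levels below 2 g(x) remain; their sum at exponent r - 1 and the loose
    factor g(x) recombine to g(x)^r.\<close>
  also have "\<dots> \<le> (\<integral>\<^sup>+x. a * (g x * (ennreal (1 / (1 - 2 powr (- (r - 1)))) * enpow (2 * g x) (r - 1))) \<partial>M)"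
    using r by (intro mult_left_mono nn_integral_mono dyadic_sum_le) auto
  also have "\<dots> = (\<integral>\<^sup>+x. ennreal (lmax_const r) * enpow (g x) r \<partial>M)"
  proof -
    have "a * (y * (ennreal (1 / (1 - 2 powr (- (r - 1)))) * enpow (2 * y) (r - 1)))
       = ennreal (lmax_const r) * enpow y r" for y
    proof -
      have 1: "enpow y r = y * enpow y (r - 1)"
        using enpow_add[of 1 "r - 1" y] r by simp
      have 2: "enpow 2 (r - 1) = ennreal (2 powr (r - 1))"
        using enpow_ennreal[of 2 "r - 1"] by simp
      have "2 powr (2 * r) = 2 powr r * (2 * 2 powr (r - 1))"
        by (simp add: powr_diff powr_add[symmetric])
      moreover define e where "e = 1 / (1 - 2 powr (1 - r))"
      ultimately have "lmax_const r = 2 * 2 powr r * (e * 2 powr (r - 1))"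
        by (simp add: lmax_const_def)
      moreover have "0 \<le> e" using c by (simp add: e_def)
      ultimately have "ennreal (lmax_const r) = a * (ennreal e * ennreal (2 powr (r - 1)))"
        by (simp add: a_def ennreal_mult)
      then have "ennreal (lmax_const r) = a * (ennreal (1 / (1 - 2 powr (- (r - 1)))) * ennreal (2 powr (r - 1)))"
        by (simp add: e_def)
      then show ?thesis using r
        by (simp add: 1 2 enpow_mult ac_simps)
    qed
    then show ?thesis by presburger
  qed
  also have "\<dots> = ennreal (lmax_const r) * (\<integral>\<^sup>+x. enpow (g x) r \<partial>M)"
    by (rule nn_integral_cmult) auto
  finally show ?thesis .
qed

section \<open>The measure on the half-plane and two dyadic grids\<close>

text \<open>The measure of the theorem on all of \<open>complex\<close>, null off the half-plane.
  General integration theory then applies, and almost-everywhere statements ignore values off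
  \<open>UH\<close>.\<close>

definition hm :: "real \<Rightarrow> complex measure" where
  "hm \<alpha> = density lborel (\<lambda>z. indicator UH z * ennreal (Im z powr \<alpha>))"

lemma UH_borel [measurable]: "UH \<in> sets borel"
  unfolding UH_def by measurable

lemma Qbox_borel [measurable]: "Qbox a b \<in> sets borel"
  unfolding Qbox_def by measurable

lemma Qbox_subset_UH: "Qbox a b \<subseteq> UH"
  by (auto simp: Qbox_def UH_def)

lemma sets_hm [simp, measurable_cong]: "sets (hm \<alpha>) = sets borel"
  and space_hm [simp]: "space (hm \<alpha>) = UNIV"
  by (simp_all add: hm_def)

lemma nn_integral_hm:
  assumes [measurable]: "g \<in> borel_measurable borel"
  shows "(\<integral>\<^sup>+z. g z \<partial>hm \<alpha>) = wint \<alpha> UH g"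
  unfolding hm_def wint_def by (subst nn_integral_density) auto

lemma wint_eq_nn_integral_hm:
  assumes [measurable]: "g \<in> borel_measurable borel" "A \<in> sets borel" and "A \<subseteq> UH"
  shows "wint \<alpha> A g = (\<integral>\<^sup>+z\<in>A. g z \<partial>hm \<alpha>)"
proof -
  have "(\<integral>\<^sup>+z\<in>A. g z \<partial>hm \<alpha>) = wint \<alpha> UH (\<lambda>z. g z * indicator A z)"
    by (rule nn_integral_hm) measurable
  also have "\<dots> = wint \<alpha> A g"
    unfolding wint_def using assms(3) by (intro nn_integral_cong) (auto split: split_indicator)
  finally show ?thesis ..
qed

section \<open>Planar Lebesgue measure as a product, and the mass of boxes\<close>

lemma measurable_Complex [measurable]: "(\<lambda>(x, y). Complex x y) \<in> borel_measurable (lborel \<Otimes>\<^sub>M lborel)"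
proof -
  have "(\<lambda>(x::real, y::real). complex_of_real x + \<i> * complex_of_real y) \<in> borel_measurable (lborel \<Otimes>\<^sub>M lborel)"
    by measurable
  then show ?thesis by (simp add: complex_eq_iff Complex_eq split_def)
qed

text \<open>Lebesgue measure is determined by its values on open boxes, where the image of the
  product measure is explicit. This opens the way to iterated integrals in the real and imaginary
  parts.\<close>

lemma lborel_complex_eq: "lborel = distr (lborel \<Otimes>\<^sub>M lborel) borel (\<lambda>(x, y). Complex x y)"
proof (rule lborel_eqI)
  fix l u :: complex
  assume lu: "\<And>b. b \<in> Basis \<Longrightarrow> l \<bullet> b \<le> u \<bullet> b"
  then have le: "Re l \<le> Re u" "Im l \<le> Im u"
    using lu[of 1] lu[of \<i>] by (auto simp: Basis_complex_def)
  have "(\<lambda>(x, y). Complex x y) -` box l u \<inter> space (lborel \<Otimes>\<^sub>M lborel) = {Re l<..<Re u} \<times> {Im l<..<Im u}"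
    by (auto simp: box_def Basis_complex_def space_pair_measure)
  then have "emeasure (distr (lborel \<Otimes>\<^sub>M lborel) borel (\<lambda>(x, y). Complex x y)) (box l u)
      = emeasure (lborel \<Otimes>\<^sub>M lborel) ({Re l<..<Re u} \<times> {Im l<..<Im u})"
    by (subst emeasure_distr) auto
  also have "\<dots> = ennreal (Re u - Re l) * ennreal (Im u - Im l)"
    using le by (subst lborel.emeasure_pair_measure_Times) auto
  also have "\<dots> = (\<Prod>b\<in>Basis. (u - l) \<bullet> b)"
    using le by (simp add: Basis_complex_def ennreal_mult'')
  finally show "emeasure (distr (lborel \<Otimes>\<^sub>M lborel) borel (\<lambda>(x, y). Complex x y)) (box l u)
      = (\<Prod>b\<in>Basis. (u - l) \<bullet> b)" .
qed simp

lemma nn_integral_lborel_complex: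
  assumes [measurable]: "f \<in> borel_measurable (borel :: complex measure)"
  shows "(\<integral>\<^sup>+z. f z \<partial>lborel) = (\<integral>\<^sup>+x. (\<integral>\<^sup>+y. f (Complex x y) \<partial>lborel) \<partial>lborel)"
proof -
  have "(\<integral>\<^sup>+z. f z \<partial>lborel) = (\<integral>\<^sup>+p. f (case p of (x, y) \<Rightarrow> Complex x y) \<partial>(lborel \<Otimes>\<^sub>M lborel))"
    by (subst lborel_complex_eq, subst nn_integral_distr) auto
  also have "\<dots> = (\<integral>\<^sup>+x. (\<integral>\<^sup>+y. f (Complex x y) \<partial>lborel) \<partial>lborel)"
    by (subst lborel.nn_integral_fst[symmetric]) (auto simp: split_def)
  finally show ?thesis .
qed

lemma nn_integral_powr_strip:
  assumes "-1 < \<alpha>" "0 \<le> h"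
  shows "(\<integral>\<^sup>+y. ennreal (y powr \<alpha>) * indicator {0<..<h} y \<partial>lborel) = ennreal (h powr (\<alpha> + 1) / (\<alpha> + 1))"
proof -
  have "(\<integral>\<^sup>+y. ennreal (y powr \<alpha>) * indicator {0<..<h} y \<partial>lborel)
      = (\<integral>\<^sup>+y. ennreal (y powr \<alpha>) * indicator {0..h} y \<partial>lborel)"
    using AE_lborel_singleton[of 0] AE_lborel_singleton[of h]
    by (intro nn_integral_cong_AE) (auto split: split_indicator)
  also have "\<dots> = ennreal (h powr (\<alpha> + 1) / (\<alpha> + 1))"
    by (intro nn_integral_has_integral_lebesgue' has_integral_powr_from_0) (use assms in auto)
  finally show ?thesis .
qed

text \<open>The base is any Borel set, so that closed, half-open and open boxes are all
  instances.\<close>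

lemma emeasure_hm_rectangle:
  assumes "-1 < \<alpha>" "0 \<le> h" and X [measurable]: "X \<in> sets borel"
  shows "emeasure (hm \<alpha>) {z. Re z \<in> X \<and> 0 < Im z \<and> Im z < h}
           = ennreal (h powr (\<alpha> + 1) / (\<alpha> + 1)) * emeasure lborel X"
proof -
  define c where "c = ennreal (h powr (\<alpha> + 1) / (\<alpha> + 1))"
  have R [measurable]: "{z. Re z \<in> X \<and> 0 < Im z \<and> Im z < h} \<in> sets borel" by measurable
  have "emeasure (hm \<alpha>) {z. Re z \<in> X \<and> 0 < Im z \<and> Im z < h}
      = (\<integral>\<^sup>+z. indicator {z. Re z \<in> X \<and> 0 < Im z \<and> Im z < h} z * ennreal (Im z powr \<alpha>) \<partial>lborel)"
    unfolding hm_def by (subst emeasure_density)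
      (auto simp: UH_def intro!: nn_integral_cong split: split_indicator)
  also have "\<dots> = (\<integral>\<^sup>+x. (\<integral>\<^sup>+y. indicator X x * (ennreal (y powr \<alpha>) * indicator {0<..<h} y) \<partial>lborel) \<partial>lborel)"
    by (subst nn_integral_lborel_complex) (auto intro!: nn_integral_cong split: split_indicator)
  also have "\<dots> = (\<integral>\<^sup>+x. c * indicator X x \<partial>lborel)"
    using assms by (subst nn_integral_cmult) (auto simp: nn_integral_powr_strip c_def mult.commute)
  also have "\<dots> = c * emeasure lborel X"
    using assms by (simp add: nn_integral_cmult_indicator)
  finally show ?thesis unfolding c_def .
qed

lemma powr_square_height:
  fixes x :: real assumes "0 < x"
  shows "x powr (1 + \<alpha>) * x = x powr (\<alpha> + 2)"
  using assms powr_add[of x "1 + \<alpha>" 1] by (simp add: add.commute)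

lemma emeasure_hm_Qbox:
  assumes "-1 < \<alpha>" "a < b"
  shows "emeasure (hm \<alpha>) (Qbox a b) = ennreal ((b - a) powr (2 + \<alpha>) / (1 + \<alpha>))"
  using emeasure_hm_rectangle[of \<alpha> "b - a" "{a..b}"] assms
  by (simp add: Qbox_def powr_square_height conj_assoc add.commute flip: ennreal_mult'')

lemma Qmeas_eq:
  assumes "-1 < \<alpha>" "a < b"
  shows "Qmeas \<alpha> a b = ennreal ((b - a) powr (2 + \<alpha>) / (1 + \<alpha>))"
  unfolding Qmeas_def emeasure_hm_Qbox[OF assms, symmetric]
  by (subst wint_eq_nn_integral_hm) (auto simp: Qbox_subset_UH)

text \<open>One-third trick: halving the scale flips the sign of the shift, so the shifted grid is still nested,
  and at every scale the endpoints of the two grids stay a third of the side length apart.\<close>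

definition grid_shift :: "bool \<Rightarrow> int \<Rightarrow> real" where
  "grid_shift t j = (if t then (if even j then 1/3 else -1/3) else 0)"

definition grid_pt :: "bool \<Rightarrow> int \<Rightarrow> int \<Rightarrow> real" where
  "grid_pt t j k = 2 powr j * (k + grid_shift t j)"

text \<open>Half-open in Re z, so that boxes of one scale are disjoint. Every box stands on the real
  axis and is as high as it is wide: only the base is subdivided.\<close>

definition grid_box :: "bool \<Rightarrow> int \<Rightarrow> int \<Rightarrow> complex set" where
  "grid_box t j k = {z. grid_pt t j k \<le> Re z \<and> Re z < grid_pt t j (k + 1) \<and> 0 < Im z \<and> Im z < 2 powr j}"

definition grid :: "bool \<Rightarrow> complex set set" where
  "grid t = range (case_prod (grid_box t))"

lemma grid_pt_diff: "grid_pt t j (k + 1) - grid_pt t j k = 2 powr j"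
  by (simp add: grid_pt_def algebra_simps)

lemma grid_pt_mono: "k \<le> l \<Longrightarrow> grid_pt t j k \<le> grid_pt t j l"
  by (simp add: grid_pt_def)

lemma grid_box_subset_Qbox: "grid_box t j k \<subseteq> Qbox (grid_pt t j k) (grid_pt t j (k + 1))"
  by (auto simp: grid_box_def Qbox_def grid_pt_diff)

lemma grid_box_borel [measurable]: "grid_box t j k \<in> sets borel"
  unfolding grid_box_def by measurable

lemma emeasure_hm_grid_box:
  assumes "-1 < \<alpha>"
  shows "emeasure (hm \<alpha>) (grid_box t j k) = ennreal ((2 powr j) powr (2 + \<alpha>) / (1 + \<alpha>))"
  using emeasure_hm_rectangle[of \<alpha> "2 powr j" "{grid_pt t j k..<grid_pt t j (k + 1)}"] assms grid_pt_diff[of t j k]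
  by (simp add: grid_box_def powr_square_height conj_assoc add.commute grid_pt_mono del: powr_powr flip: ennreal_mult'')

lemma grid_box_parent: "\<exists>l. grid_box t j k \<subseteq> grid_box t (j + 1) l"
proof -
  \<comment> \<open>m is 2 \<open>grid_shift t (j + 1)\<close> - \<open>grid_shift t j\<close>, an
    integer because the alternating thirds give -2/3 - 1/3 or 2/3 + 1/3.\<close>
  define m :: int where "m = (if t then (if even j then -1 else 1) else 0)"
  have pt: "grid_pt t (j + 1) l = grid_pt t j (2 * l + m)" for l
    by (simp add: grid_pt_def grid_shift_def m_def powr_add algebra_simps)
  define l where "l = (k - m) div 2"
  have l: "2 * l + m \<le> k" "k + 1 \<le> 2 * (l + 1) + m" by (auto simp: l_def)
  have "grid_pt t (j + 1) l \<le> grid_pt t j k" "grid_pt t j (k + 1) \<le> grid_pt t (j + 1) (l + 1)"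
    unfolding pt using l by (auto intro: grid_pt_mono)
  moreover have "2 powr j \<le> 2 powr (j + 1)" by simp
  ultimately show ?thesis unfolding grid_box_def by (intro exI[of _ l]) (auto simp del: powr_le_cancel_iff)
qed

lemma grid_box_ancestor:
  assumes "i \<le> j" shows "\<exists>l. grid_box t i k \<subseteq> grid_box t j l"
  using assms
proof (induction j rule: int_ge_induct)
  case base
  then show ?case by blast
next
  case (step j)
  then show ?case using grid_box_parent[of t j] by (meson subset_trans)
qed

lemma grid_box_disjoint:
  assumes "z \<in> grid_box t j k" "z \<in> grid_box t j l" shows "k = l"
proof -
  have "k = \<lfloor>Re z / 2 powr j - grid_shift t j\<rfloor>" if "z \<in> grid_box t j k" for k
    using that by (intro floor_unique[symmetric]) (auto simp: grid_box_def grid_pt_def field_simps)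
  with assms show ?thesis by blast
qed

lemma laminar_grid: "laminar (grid t)"
proof -
  have *: "A \<inter> B = {} \<or> A \<subseteq> B" if "A = grid_box t i k" "B = grid_box t j l" "i \<le> j" for A B i j k l
    using grid_box_ancestor[OF that(3), of t k] grid_box_disjoint that by blast
  show ?thesis unfolding laminar_def
  proof (intro ballI)
    fix A B assume "A \<in> grid t" "B \<in> grid t"
    then obtain i k j l where AB: "A = grid_box t i k" "B = grid_box t j l"
      by (auto simp: grid_def)
    show "A \<inter> B = {} \<or> A \<subseteq> B \<or> B \<subseteq> A"
      using *[OF AB] *[OF AB(2,1)] by (cases "i \<le> j") auto
  qed
qed

lemma countable_grid: "countable (grid t)"
  unfolding grid_def by (intro countable_image) auto

lemma grid_borel: "grid t \<subseteq> sets borel"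
  unfolding grid_def by auto

text \<open>The scale satisfies 3 (b - a) \<le> 2^j < 6 (b - a). If each grid had an endpoint in (a,
  b], the two would be less than b - a apart, against their separation of at least 2^j / 3.\<close>

lemma Qbox_subset_grid_box:
  assumes "a < b"
  obtains t j k where "Qbox a b \<subseteq> grid_box t j k" "2 powr j < 6 * (b - a)"
proof -
  obtain j :: int where j: "2 powr j < 6 * (b - a)" "6 * (b - a) \<le> 2 * 2 powr j"
    using dyadic_level[of "6 * (b - a)"] assms by auto
  define k where "k t = \<lfloor>a / 2 powr j - grid_shift t j\<rfloor>" for t
  have k: "grid_pt t j (k t) \<le> a" "a < grid_pt t j (k t + 1)" for t
  proof -
    have "real_of_int (k t) \<le> a / 2 powr j - grid_shift t j" "a / 2 powr j - grid_shift t j < real_of_int (k t) + 1"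
      unfolding k_def by linarith+
    then show "grid_pt t j (k t) \<le> a" "a < grid_pt t j (k t + 1)" unfolding grid_pt_def by (auto simp: field_simps)
  qed
  have "\<exists>t. b < grid_pt t j (k t + 1)"
  proof (rule ccontr)
    assume "\<not> ?thesis"
    then have le: "grid_pt t j (k t + 1) \<le> b" for t by (auto simp: not_less)
    define D where "D = grid_pt True j (k True + 1) - grid_pt False j (k False + 1)"
    have D: "\<bar>D\<bar> < b - a"
      using le[of True] le[of False] k(2)[of True] k(2)[of False] by (auto simp: D_def)
    define m where "m = k True - k False"
    have "D = 2 powr j * (of_int m + grid_shift True j)"
      by (simp add: D_def grid_pt_def grid_shift_def m_def algebra_simps)
    then have "\<bar>D\<bar> = 2 powr j * \<bar>of_int m + grid_shift True j\<bar>" by (simp add: abs_mult)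
    moreover have "\<bar>of_int m + grid_shift True j\<bar> \<ge> 1/3"
      unfolding grid_shift_def by (cases "m \<le> -1"; cases "m \<ge> 1") (auto simp: abs_if)
    ultimately have "2 powr j * (1/3) \<le> \<bar>D\<bar>" by simp
    with D j show False by simp
  qed
  then obtain t where t: "b < grid_pt t j (k t + 1)" ..
  have "b - a < 2 powr j" using j assms by simp
  then have "Qbox a b \<subseteq> grid_box t j (k t)"
    using k(1)[of t] t by (auto simp: Qbox_def grid_box_def)
  then show thesis using that j by blast
qed

section \<open>The bound for positive weights\<close>

locale off_diagonal =
  fixes \<alpha> \<gamma> p q :: real
  assumes alpha: "-1 < \<alpha>" and gamma: "0 \<le> \<gamma>" "\<gamma> < 2 + \<alpha>" and p: "1 < p"
    and p_less: "\<gamma> = 0 \<or> p < (2 + \<alpha>) / \<gamma>" and q_eq: "1 / q = 1 / p - \<gamma> / (2 + \<alpha>)"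
begin

section \<open>Exponent identities and the estimate on one box\<close>

definition "\<theta> = \<gamma> / (2 + \<alpha>)"
definition "p' = conj_exp p"
definition "\<kappa> = p' / q * (1 - \<theta>)"

lemma theta: "0 \<le> \<theta>" "\<theta> < 1" "(2 + \<alpha>) * (1 - \<theta>) = 2 + \<alpha> - \<gamma>"
  using alpha gamma by (auto simp: \<theta>_def field_simps)

lemma inverse_q: "1 / q = 1 / p - \<theta>"
  using q_eq by (simp add: \<theta>_def)

text \<open>The upper bound on p says \<theta> < 1 / p, hence 1 / q > 0. This also excludes q = 0,
  where division by zero would give 1 / q = 0.\<close>

lemma q_pos: "0 < q"
proof -
  have "\<theta> < 1 / p"
  proof (cases "\<gamma> = 0")
    case False
    then show ?thesis using p_less p alpha gamma
      by (simp add: \<theta>_def pos_less_divide_eq pos_divide_less_eq mult.commute)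
  next
    case True
    then have "\<theta> = 0" unfolding \<theta>_def by simp
    then show ?thesis using p by simp
  qed
  then show ?thesis using inverse_q p by (metis diff_gt_0_iff_gt zero_less_divide_1_iff)
qed

lemma p'_gt_1: "1 < p'" and p'_mult: "p' * (p - 1) = p" and p'_div: "p / p' = p - 1" and inverse_p': "1 / p' = 1 - 1 / p"
  using p by (auto simp: p'_def conj_exp_def field_simps)

lemma p_div_q: "p / q = 1 - p * \<theta>"
  using arg_cong[OF inverse_q, of "\<lambda>x. p * x"] p by (simp add: algebra_simps)

lemma kappa_pos: "0 < \<kappa>"
  using p'_gt_1 q_pos theta by (simp add: \<kappa>_def)

lemma kappa_mult: "\<kappa> * (q / p') = 1 - \<theta>"
  using p'_gt_1 q_pos by (simp add: \<kappa>_def)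

text \<open>A consequence of 1 - \<theta> = 1 / q + 1 / p'. It places the outer maximal operator
  above exponent 1 and is the identity behind u^(1 - q \<kappa>) = s.\<close>

lemma q_kappa: "q * \<kappa> = 1 + p' / q"
proof -
  have "1 - \<theta> = 1 / q + 1 / p'" using inverse_q inverse_p' by simp
  then have "q * \<kappa> = p' * (1 / q + 1 / p')" using q_pos by (simp add: \<kappa>_def)
  then show ?thesis using p'_gt_1 by (simp add: distrib_left)
qed

lemma q_kappa_gt_1: "1 < q * \<kappa>"
  using p'_gt_1 q_pos by (simp add: q_kappa)

text \<open>Write F = S (F / S) and split F / S into its powers p \<theta> and p / q. Hoelder's
  inequality bounds (F / S)^(p \<theta>) S^\<theta> by a multiple of H^\<theta>; the remaining (S /
  m)^(1 - \<theta>) costs B^\<kappa> and releases (m / U)^\<kappa>.\<close>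

lemma box_average_bound:
  fixes U S m F H B :: real
  assumes pos: "0 < U" "0 < S" "0 < m" "0 < F" "0 < H"
    and B: "U / m * (S / m) powr (q / p') \<le> B"
    and F: "F \<le> 2 * H powr (1 / p) * S powr (1 - 1 / p)"
  shows "m powr (- (1 - \<theta>)) * F
    \<le> 2 powr (p * \<theta>) * B powr \<kappa> * H powr \<theta> * (m / U * (F / S) powr (p / (q * \<kappa>))) powr \<kappa>"
proof -
  \<comment> \<open>The power \<kappa> turns (S / m)^(q / p') into (S / m)^(1 - \<theta>).\<close>
  have "(U / m * (S / m) powr (q / p')) powr \<kappa> \<le> B powr \<kappa>"
    using B pos kappa_pos by (intro powr_mono2) auto
  then have "(U / m) powr \<kappa> * (S / m) powr (1 - \<theta>) \<le> B powr \<kappa>"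
    using kappa_mult by (simp only: powr_mult powr_powr mult.commute[of _ \<kappa>])
  then have 1: "(S / m) powr (1 - \<theta>) \<le> B powr \<kappa> * (m / U) powr \<kappa>"
    using pos by (simp add: powr_divide field_simps)
  have "F / S \<le> 2 * H powr (1 / p) * S powr (1 - 1 / p) / S"
    using F pos by (intro divide_right_mono) auto
  also have "\<dots> = 2 * H powr (1 / p) * S powr (- (1 / p))"
    using pos by (simp add: powr_diff powr_minus field_simps)
  finally have "(F / S) powr (p * \<theta>) \<le> (2 * H powr (1 / p) * S powr (- (1 / p))) powr (p * \<theta>)"
    using pos p theta by (intro powr_mono2) auto
  also have "\<dots> = 2 powr (p * \<theta>) * H powr \<theta> * S powr (- \<theta>)"
    using p by (simp add: powr_mult powr_powr)
  finally have 2: "(F / S) powr (p * \<theta>) * S powr \<theta> \<le> 2 powr (p * \<theta>) * H powr \<theta>"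
    using pos by (simp add: powr_minus field_simps)
  have e: "p / (q * \<kappa>) * \<kappa> = p / q" using kappa_pos by simp
  have "F / S = (F / S) powr (p * \<theta>) * (F / S) powr (p / q)"
    using pos p_div_q by (simp add: powr_add[symmetric])
  then have "m powr (- (1 - \<theta>)) * F
      = (S / m) powr (1 - \<theta>) * (F / S) powr (p / q) * ((F / S) powr (p * \<theta>) * S powr \<theta>)"
  proof -
    assume FS: "F / S = (F / S) powr (p * \<theta>) * (F / S) powr (p / q)"
    have "(S / m) powr (1 - \<theta>) * S powr \<theta> = S * m powr (- (1 - \<theta>))"
      using pos powr_add[of S "1 - \<theta>" \<theta>] powr_minus_divide[of m "1 - \<theta>"]
      by (simp add: powr_divide mult.commute mult.left_commute)
    then have "(S / m) powr (1 - \<theta>) * S powr \<theta> * (F / S) = m powr (- (1 - \<theta>)) * F"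
      using pos by simp
    then show ?thesis by (subst (asm) FS) (simp add: ac_simps)
  qed
  also have "\<dots> \<le> B powr \<kappa> * (m / U) powr \<kappa> * (F / S) powr (p / q) * (2 powr (p * \<theta>) * H powr \<theta>)"
    by (rule mult_mono[OF mult_right_mono[OF 1] 2]) (use pos in auto)
  also have "\<dots> = 2 powr (p * \<theta>) * B powr \<kappa> * H powr \<theta> * (m / U * (F / S) powr (p / (q * \<kappa>))) powr \<kappa>"
    by (simp only: powr_mult powr_powr e) (simp only: ac_simps)
  finally show ?thesis .
qed

end


section \<open>Dyadic domination for strictly positive weights\<close>

text \<open>Strict positivity everywhere makes all powers of the weight finite and invertible.
  General weights are later altered on a null set to fit.\<close>

locale off_diagonal_weight = off_diagonal +
  fixes w :: "complex \<Rightarrow> real" and B :: real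
  assumes w_measurable [measurable]: "w \<in> borel_measurable borel" and w_pos: "0 < w z"
    and characteristic_le: "a < b \<Longrightarrow>
      (\<integral>\<^sup>+z\<in>Qbox a b. ennreal (w z powr q) \<partial>hm \<alpha>) / emeasure (hm \<alpha>) (Qbox a b) *
      enpow ((\<integral>\<^sup>+z\<in>Qbox a b. ennreal (w z powr (- p')) \<partial>hm \<alpha>) / emeasure (hm \<alpha>) (Qbox a b)) (q / p') \<le> ennreal B"
begin

text \<open>U and S are positive because w > 0 on a set of positive mass, and finite because their
  combination is at most B while neither factor vanishes. The enclosing \<open>Qbox\<close> has the
  same mass m, so the hypothesis passes to the half-open box without loss.\<close>

lemma grid_box_mass:
  obtains U S m :: real where "0 < U" "0 < S" "0 < m" "m = (2 powr j) powr (2 + \<alpha>) / (1 + \<alpha>)"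
    "emeasure (hm \<alpha>) (grid_box t j k) = ennreal m"
    "(\<integral>\<^sup>+z\<in>grid_box t j k. ennreal (w z powr q) \<partial>hm \<alpha>) = ennreal U"
    "(\<integral>\<^sup>+z\<in>grid_box t j k. ennreal (w z powr (- p')) \<partial>hm \<alpha>) = ennreal S"
    "U / m * (S / m) powr (q / p') \<le> B"
proof -
  define G where "G = grid_box t j k"
  have G [measurable]: "G \<in> sets borel" by (simp add: G_def)
  define Q where "Q = Qbox (grid_pt t j k) (grid_pt t j (k + 1))"
  define m where "m = (2 powr j) powr (2 + \<alpha>) / (1 + \<alpha>)"
  have m: "0 < m" using alpha by (simp add: m_def)
  have lt: "grid_pt t j k < grid_pt t j (k + 1)"
    using grid_pt_diff[of t j k] by (metis diff_gt_0_iff_gt powr_gt_zero zero_neq_numeral)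
  have mQ: "emeasure (hm \<alpha>) Q = ennreal m"
    using emeasure_hm_Qbox[OF alpha lt] by (simp add: Q_def grid_pt_diff m_def)
  have mG: "emeasure (hm \<alpha>) G = ennreal m"
    using emeasure_hm_grid_box[OF alpha] by (simp add: G_def m_def)
  have sub: "G \<subseteq> Q" unfolding G_def Q_def by (rule grid_box_subset_Qbox)
  have nz: "(\<integral>\<^sup>+z\<in>G. ennreal (w z powr e) \<partial>hm \<alpha>) \<noteq> 0" for e
  proof
    assume "(\<integral>\<^sup>+z\<in>G. ennreal (w z powr e) \<partial>hm \<alpha>) = 0"
    then have "AE z in hm \<alpha>. z \<notin> G"
      using w_pos less_imp_neq[OF w_pos]
      by (subst (asm) nn_integral_0_iff_AE) (auto simp: indicator_def split: if_splits)
    then have "emeasure (hm \<alpha>) G = 0"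
      by (subst (asm) AE_iff_measurable[of G]) auto
    then show False using mG m by simp
  qed
  define X Y where "X = (\<integral>\<^sup>+z\<in>G. ennreal (w z powr q) \<partial>hm \<alpha>)" and "Y = (\<integral>\<^sup>+z\<in>G. ennreal (w z powr (- p')) \<partial>hm \<alpha>)"
  have e: "0 < q / p'" using q_pos p'_gt_1 by simp
  have "X / ennreal m * enpow (Y / ennreal m) (q / p')
      \<le> (\<integral>\<^sup>+z\<in>Q. ennreal (w z powr q) \<partial>hm \<alpha>) / ennreal m *
        enpow ((\<integral>\<^sup>+z\<in>Q. ennreal (w z powr (- p')) \<partial>hm \<alpha>) / ennreal m) (q / p')"
    unfolding X_def Y_def using sub e
    by (intro mult_mono divide_right_mono_ennreal enpow_mono nn_integral_mono) (auto split: split_indicator)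
  also have "\<dots> \<le> ennreal B" using characteristic_le[OF lt] by (simp add: mQ Q_def[symmetric])
  finally have le: "X / ennreal m * enpow (Y / ennreal m) (q / p') \<le> ennreal B" .
  have XY: "X \<noteq> 0" "Y \<noteq> 0" using nz by (auto simp: X_def Y_def)
  have "enpow (Y / ennreal m) (q / p') \<noteq> 0"
    using XY(2) m e by (cases Y) (auto simp: divide_ennreal enpow_ennreal ennreal_top_divide)
  then have "X \<noteq> top" using le m by (auto simp: ennreal_top_divide ennreal_top_mult top_unique)
  then obtain U where U: "X = ennreal U" "0 < U" using XY by (cases X) (auto simp: less_le)
  have "Y \<noteq> top"
    using le m U e by (auto simp: ennreal_top_divide ennreal_mult_top top_unique divide_ennreal)
  then obtain S where S: "Y = ennreal S" "0 < S" using XY by (cases Y) (auto simp: less_le)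
  have "ennreal (U / m * (S / m) powr (q / p')) \<le> ennreal B"
    using le m U S e by (subst ennreal_mult) (auto simp: divide_ennreal enpow_ennreal)
  moreover have "0 < U / m * (S / m) powr (q / p')" using m U S by simp
  ultimately have "U / m * (S / m) powr (q / p') \<le> B"
    by (metis ennreal_le_iff2 less_le_not_le order.trans)
  then show thesis using that[of U S m] U S m mG by (simp add: G_def X_def Y_def m_def)
qed

text \<open>Finiteness of F lets the estimate on a box be carried out in the reals, and H > 0 for F
  > 0 provides the positivity it asks for.\<close>

lemma Hoelder_box:
  assumes A [measurable]: "A \<in> sets borel" and f [measurable]: "f \<in> borel_measurable borel"
    and S: "(\<integral>\<^sup>+z\<in>A. ennreal (w z powr (- p')) \<partial>hm \<alpha>) = ennreal S" "0 < S"
    and H: "(\<integral>\<^sup>+z. ennreal ((w z * norm (f z :: complex)) powr p) \<partial>hm \<alpha>) = ennreal H" "0 \<le> H"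
  obtains F where "(\<integral>\<^sup>+z\<in>A. ennreal (norm (f z)) \<partial>hm \<alpha>) = ennreal F" "0 \<le> F"
    "F \<le> 2 * H powr (1 / p) * S powr (1 - 1 / p)" "F = 0 \<or> 0 < H"
proof -
  define X where "X = (\<integral>\<^sup>+z\<in>A. ennreal (norm (f z)) \<partial>hm \<alpha>)"
  have le: "X \<le> ennreal (c * S + c powr (1 - p) * H)" if c: "0 < c" for c
  proof -
    \<comment> \<open>The pointwise bound \<open>h \<le> c + c^(1 - p) h^p\<close> for \<open>h = |f| w^p'\<close>; optimising \<open>c\<close> gives Hoelder's
      inequality up to the factor 2.\<close>
    have pt: "norm (f z) \<le> c * w z powr (- p') + c powr (1 - p) * (w z * norm (f z)) powr p" for z
    proof -
      define n s where "n = norm (f z)" and "s = w z powr (- p')"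
      have s: "0 < s" "0 \<le> n" using w_pos[of z] by (auto simp: s_def n_def)
      have young: "x \<le> 1 + x powr p" if "0 \<le> x" for x :: real
      proof (cases "x \<le> 1")
        case False
        then have "x powr 1 \<le> x powr p" using p by (intro powr_mono) auto
        then show ?thesis using that by simp
      qed (simp add: add_increasing2)
      have "n = c * s * (n / (c * s))" using s c by simp
      also have "\<dots> \<le> c * s * (1 + (n / (c * s)) powr p)"
        using s c by (intro mult_left_mono young) auto
      also have "\<dots> = c * s + c powr (1 - p) * (s powr (1 - p) * n powr p)"
        using s c by (simp add: powr_divide powr_mult powr_diff field_simps)
      also have "s powr (1 - p) = w z powr p"
        using p'_mult by (simp add: s_def powr_powr algebra_simps)
      finally show ?thesis by (simp add: n_def s_def powr_mult)
    qed
    have "X \<le> (\<integral>\<^sup>+z. ennreal c * (ennreal (w z powr (- p')) * indicator A z) + ennreal (c powr (1 - p)) * ennreal ((w z * norm (f z)) powr p) \<partial>hm \<alpha>)"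
      unfolding X_def using pt c
      by (intro nn_integral_mono) (auto split: split_indicator simp: ennreal_plus[symmetric] ennreal_mult[symmetric] intro!: ennreal_leI simp del: ennreal_plus)
    also have "\<dots> = ennreal c * ennreal S + ennreal (c powr (1 - p)) * ennreal H"
      by (subst nn_integral_add) (auto simp: nn_integral_cmult S H)
    also have "\<dots> = ennreal (c * S + c powr (1 - p) * H)"
      using c S H by (simp add: ennreal_mult)
    finally show ?thesis .
  qed
  have "X \<noteq> top" using le[of 1] by (auto simp: top_unique)
  then obtain F where F: "X = ennreal F" "0 \<le> F" by (cases X) auto
  have le: "F \<le> c * S + c powr (1 - p) * H" if "0 < c" for c
    using le[OF that] F S H that by (simp add: ennreal_le_iff del: ennreal_plus)
  show thesis
  proof (rule that[of F])
    show H_pos: "F = 0 \<or> 0 < H"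
    proof (rule ccontr)
      assume "\<not> (F = 0 \<or> 0 < H)"
      then have "H = 0" "F \<noteq> 0" using H by auto
      \<comment> \<open>With H = 0 only c S is left, and this c makes it F / 2.\<close>
      with le[of "F / (2 * S)"] F S show False by (auto simp: field_simps)
    qed
    show "F \<le> 2 * H powr (1 / p) * S powr (1 - 1 / p)"
    proof (cases "F = 0")
      case False
      then have "0 < H" using H_pos by simp
      \<comment> \<open>At c = (H / S)^(1 / p) both terms equal H^(1 / p) S^(1 - 1 / p), whence the
        factor 2.\<close>
      have 1: "(H / S) powr (1 / p) * S = H powr (1 / p) * S powr (1 - 1 / p)"
        using \<open>0 < H\<close> S by (simp add: powr_divide powr_diff)
      have "((H / S) powr (1 / p)) powr (1 - p) * H = H powr ((1 - p) / p) * S powr (- ((1 - p) / p)) * H"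
        using \<open>0 < H\<close> S powr_minus_divide[of S "(1 - p) / p"] by (simp add: powr_powr powr_divide)
      also have "\<dots> = (H powr ((1 - p) / p) * H powr 1) * S powr (- ((1 - p) / p))"
        using \<open>0 < H\<close> by simp
      also have "\<dots> = H powr (1 / p) * S powr (1 - 1 / p)"
      proof -
        have "(1 - p) / p = 1 / p - 1" using p by (simp add: diff_divide_distrib)
        then show ?thesis unfolding powr_add[symmetric] by simp
      qed
      finally show ?thesis using le[of "(H / S) powr (1 / p)"] \<open>0 < H\<close> S 1 by simp
    qed simp
  qed (use F X_def in auto)
qed

end

context off_diagonal
begin

text \<open>The 6 is the side ratio in the covering by grid boxes, 1 + \<alpha> comes from the mass
  l^(2 + \<alpha>) / (1 + \<alpha>), and 2^(p \<theta>) is the loss in Hoelder's inequality.\<close>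

definition "box_const = 6 powr (2 + \<alpha> - \<gamma>) * (1 + \<alpha>) powr (- (1 - \<theta>)) * 2 powr (p * \<theta>)"

text \<open>The 2 counts the grids; the two maximal constants multiply because the operators are
  composed.\<close>

definition "strong_const = box_const * (2 * (lmax_const (q * \<kappa>) * lmax_const p)) powr (1 / q)"

lemma strong_const_pos: "0 < strong_const"
  using lmax_const_pos[OF p] lmax_const_pos[OF q_kappa_gt_1] alpha by (simp add: strong_const_def box_const_def)

end

context off_diagonal_weight
begin

definition "mu_u = density (hm \<alpha>) (\<lambda>z. ennreal (w z powr q))"
definition "mu_s = density (hm \<alpha>) (\<lambda>z. ennreal (w z powr (- p')))"

text \<open>This is M_s(|f| / s), since 1 / s = w^p'.\<close>

definition inner_max :: "(complex \<Rightarrow> complex) \<Rightarrow> bool \<Rightarrow> complex \<Rightarrow> ennreal" where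
  "inner_max f t = lmax mu_s (grid t) (\<lambda>z. ennreal (norm (f z) * w z powr p'))"

text \<open>The factor w^(-q) is 1 / u. The power p / (q \<kappa>) matches the two norms: raised to
  q \<kappa> it returns the p-th power of the inner maximal function.\<close>

definition inner_fun :: "(complex \<Rightarrow> complex) \<Rightarrow> bool \<Rightarrow> complex \<Rightarrow> ennreal" where
  "inner_fun f t z = enpow (inner_max f t z) (p / (q * \<kappa>)) * ennreal (w z powr (- q))"

definition outer_max :: "(complex \<Rightarrow> complex) \<Rightarrow> bool \<Rightarrow> complex \<Rightarrow> ennreal" where
  "outer_max f t = lmax mu_u (grid t) (inner_fun f t)"

lemma sets_mu [simp, measurable_cong]: "sets mu_u = sets borel" "sets mu_s = sets borel"
  by (auto simp: mu_u_def mu_s_def)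

lemma grid_sets: "grid t \<subseteq> sets mu_u" "grid t \<subseteq> sets mu_s"
  using grid_borel by auto

lemma inner_max_measurable [measurable]: "inner_max f t \<in> borel_measurable borel"
  using borel_measurable_lmax[OF grid_sets(2) countable_grid] unfolding inner_max_def
  by (simp cong: measurable_cong_sets)

lemma inner_fun_measurable [measurable]: "inner_fun f t \<in> borel_measurable borel"
  unfolding inner_fun_def by measurable

lemma outer_max_measurable [measurable]: "outer_max f t \<in> borel_measurable borel"
  using borel_measurable_lmax[OF grid_sets(1) countable_grid] unfolding outer_max_def
  by (simp cong: measurable_cong_sets)

lemma lmax_ge:
  assumes "A \<in> F" "x \<in> A"
  shows "(\<integral>\<^sup>+y\<in>A. g y \<partial>M) / emeasure M A \<le> lmax M F g x"
  unfolding lmax_def by (rule SUP_upper) (use assms in auto)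

text \<open>Throughout G the inner maximal function is at least F / S, so m (F / S)^(p / (q
  \<kappa>)) is at most the u-integral of \<open>inner_fun\<close> over G. Dividing by U = u(G) puts
  the last factor of the one-box estimate below \<open>outer_max\<close> at z. The maximum over both
  grids serves every interval, whichever grid captures it.\<close>

lemma maxop_pointwise:
  assumes f [measurable]: "f \<in> borel_measurable borel"
    and H: "(\<integral>\<^sup>+z. ennreal ((w z * norm (f z :: complex)) powr p) \<partial>hm \<alpha>) = ennreal H" "0 \<le> H"
  shows "maxop \<alpha> \<gamma> f z \<le> ennreal (box_const * B powr \<kappa> * H powr \<theta>) *
    enpow (max (outer_max f True z) (outer_max f False z)) \<kappa>"
  unfolding maxop_def
proof (rule SUP_least, clarify, unfold fst_conv snd_conv)
  fix a b :: real assume ab: "a < b" "z \<in> Qbox a b"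
  let ?R = "ennreal (box_const * B powr \<kappa> * H powr \<theta>) * enpow (max (outer_max f True z) (outer_max f False z)) \<kappa>"
  obtain t j k where sub: "Qbox a b \<subseteq> grid_box t j k" and j: "2 powr j < 6 * (b - a)"
    by (rule Qbox_subset_grid_box[OF ab(1)])
  define G where "G = grid_box t j k"
  have G [measurable]: "G \<in> sets borel" and Gg: "G \<in> grid t" by (auto simp: G_def grid_def)
  define l :: real where "l = 2 powr j"
  have l: "0 < l" by (simp add: l_def)
  obtain U S m where USm: "0 < U" "0 < S" "0 < m" "m = l powr (2 + \<alpha>) / (1 + \<alpha>)"
    and mG: "emeasure (hm \<alpha>) G = ennreal m"
    and UG: "(\<integral>\<^sup>+z\<in>G. ennreal (w z powr q) \<partial>hm \<alpha>) = ennreal U"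
    and SG: "(\<integral>\<^sup>+z\<in>G. ennreal (w z powr (- p')) \<partial>hm \<alpha>) = ennreal S"
    and UB: "U / m * (S / m) powr (q / p') \<le> B"
    unfolding G_def l_def by (rule grid_box_mass[of j t k])
  obtain F where F: "(\<integral>\<^sup>+z\<in>G. ennreal (norm (f z)) \<partial>hm \<alpha>) = ennreal F" "0 \<le> F"
    "F \<le> 2 * H powr (1 / p) * S powr (1 - 1 / p)" "F = 0 \<or> 0 < H"
    by (rule Hoelder_box[OF G f SG USm(2) H])
  have "wint \<alpha> (Qbox a b) (\<lambda>w. ennreal (norm (f w))) = (\<integral>\<^sup>+z\<in>Qbox a b. ennreal (norm (f z)) \<partial>hm \<alpha>)"
    by (rule wint_eq_nn_integral_hm) (auto simp: Qbox_subset_UH)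
  also have "\<dots> \<le> ennreal F"
    unfolding F(1)[symmetric] using sub by (intro nn_integral_mono) (auto simp: G_def split: split_indicator)
  finally have wF: "wint \<alpha> (Qbox a b) (\<lambda>w. ennreal (norm (f w))) \<le> ennreal F" .
  show "ennreal ((b - a) powr - (2 + \<alpha> - \<gamma>)) * wint \<alpha> (Qbox a b) (\<lambda>w. ennreal (norm (f w))) \<le> ?R"
  proof (cases "F = 0")
    case True
    then show ?thesis using wF by simp
  next
    case False
    then have FH: "0 < F" "0 < H" using F by auto
    define r where "r = m / U * (F / S) powr (p / (q * \<kappa>))"
    have r: "0 < r" using USm(1-3) FH by (simp add: r_def)
    have inner_ge: "ennreal (F / S) \<le> inner_max f t y" if "y \<in> G" for y
    proof -
      have "ennreal (F / S) = (\<integral>\<^sup>+y\<in>G. ennreal (norm (f y) * w y powr p') \<partial>mu_s) / emeasure mu_s G"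
      proof -
        have "ennreal (w y powr (- p')) * (ennreal (norm (f y) * w y powr p') * indicator G y) = ennreal (norm (f y)) * indicator G y" for y
        proof -
          have "w y powr (- p') * (norm (f y) * w y powr p') = norm (f y)"
            using w_pos[of y] powr_minus[of "w y" p'] by simp
          then have "ennreal (w y powr (- p')) * ennreal (norm (f y) * w y powr p') = ennreal (norm (f y))"
            by (subst ennreal_mult[symmetric]) auto
          then show ?thesis by (simp only: mult.assoc[symmetric])
        qed
        then have "(\<integral>\<^sup>+y\<in>G. ennreal (norm (f y) * w y powr p') \<partial>mu_s) = (\<integral>\<^sup>+z\<in>G. ennreal (norm (f z)) \<partial>hm \<alpha>)"
          unfolding mu_s_def by (subst nn_integral_density) auto
        moreover have "emeasure mu_s G = ennreal S"
          unfolding mu_s_def SG[symmetric] by (simp add: emeasure_density)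
        ultimately show ?thesis using F USm(1-3) by (simp add: divide_ennreal)
      qed
      also have "\<dots> \<le> inner_max f t y" unfolding inner_max_def by (rule lmax_ge) fact+
      finally show ?thesis .
    qed
    have "ennreal ((F / S) powr (p / (q * \<kappa>))) * ennreal m = (\<integral>\<^sup>+y\<in>G. ennreal ((F / S) powr (p / (q * \<kappa>))) \<partial>hm \<alpha>)"
      by (simp add: nn_integral_cmult_indicator mG)
    also have "\<dots> \<le> (\<integral>\<^sup>+y. ennreal (w y powr q) * (inner_fun f t y * indicator G y) \<partial>hm \<alpha>)"
    proof (intro nn_integral_mono)
      fix y
      show "ennreal ((F / S) powr (p / (q * \<kappa>))) * indicator G y \<le> ennreal (w y powr q) * (inner_fun f t y * indicator G y)"
      proof (cases "y \<in> G")
        case True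
        have "ennreal ((F / S) powr (p / (q * \<kappa>))) = enpow (ennreal (F / S)) (p / (q * \<kappa>))"
          using FH USm(1-3) by (subst enpow_ennreal) auto
        also have "\<dots> \<le> enpow (inner_max f t y) (p / (q * \<kappa>))"
          using p q_kappa_gt_1 by (intro enpow_mono inner_ge True) auto
        also have "\<dots> = ennreal (w y powr q) * inner_fun f t y"
        proof -
          have "ennreal (w y powr q) * ennreal (w y powr (- q)) = 1"
            using w_pos[of y] by (simp add: ennreal_mult'[symmetric] powr_minus)
          then have "enpow (inner_max f t y) (p / (q * \<kappa>)) = ennreal (w y powr q) * ennreal (w y powr (- q)) * enpow (inner_max f t y) (p / (q * \<kappa>))"
            by simp
          then show ?thesis unfolding inner_fun_def by (simp only: ac_simps)
        qed
        finally show ?thesis using True by simp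
      qed simp
    qed
    also have "\<dots> = (\<integral>\<^sup>+y\<in>G. inner_fun f t y \<partial>mu_u)"
      unfolding mu_u_def by (subst nn_integral_density) auto
    finally have "ennreal ((F / S) powr (p / (q * \<kappa>))) * ennreal m / ennreal U \<le> (\<integral>\<^sup>+y\<in>G. inner_fun f t y \<partial>mu_u) / emeasure mu_u G"
      unfolding mu_u_def UG[symmetric] by (simp add: emeasure_density divide_right_mono_ennreal)
    also have "\<dots> \<le> outer_max f t z"
      unfolding outer_max_def by (rule lmax_ge[OF Gg]) (use sub ab in \<open>auto simp: G_def\<close>)
    also have "\<dots> \<le> max (outer_max f True z) (outer_max f False z)"
      by (cases t) auto
    also have "ennreal ((F / S) powr (p / (q * \<kappa>))) * ennreal m / ennreal U = ennreal r"
      using USm(1-3) FH by (simp add: r_def ennreal_mult''[symmetric] divide_ennreal mult.commute)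
    finally have r_le: "ennreal r \<le> max (outer_max f True z) (outer_max f False z)" .
    have e: "0 < 2 + \<alpha> - \<gamma>" using gamma by simp
    \<comment> \<open>The exponent is negative and the interval is longer than l / 6.\<close>
    have "(b - a) powr - (2 + \<alpha> - \<gamma>) \<le> (l / 6) powr - (2 + \<alpha> - \<gamma>)"
      using j l e by (intro powr_mono2') (auto simp: l_def)
    also have "\<dots> = 6 powr (2 + \<alpha> - \<gamma>) * l powr - (2 + \<alpha> - \<gamma>)"
      using l powr_minus_divide[of 6 "2 + \<alpha> - \<gamma>"] by (simp add: powr_divide)
    also have "l powr - (2 + \<alpha> - \<gamma>) = (1 + \<alpha>) powr (- (1 - \<theta>)) * m powr (- (1 - \<theta>))"
    proof -
      \<comment> \<open>As (2 + \<alpha>) (1 - \<theta>) = 2 + \<alpha> - \<gamma>, the fractional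
        normalisation is the mass to the power \<theta> - 1, up to a constant.\<close>
      have "l powr - (2 + \<alpha> - \<gamma>) = (l powr (2 + \<alpha>)) powr (- (1 - \<theta>))"
        unfolding powr_powr theta(3)[symmetric] by (simp add: algebra_simps)
      also have "l powr (2 + \<alpha>) = (1 + \<alpha>) * m" using USm alpha by simp
      finally show ?thesis by (simp only: powr_mult)
    qed
    finally have ba: "(b - a) powr - (2 + \<alpha> - \<gamma>) \<le> 6 powr (2 + \<alpha> - \<gamma>) * ((1 + \<alpha>) powr (- (1 - \<theta>)) * m powr (- (1 - \<theta>)))" .
    have "(b - a) powr - (2 + \<alpha> - \<gamma>) * F \<le> 6 powr (2 + \<alpha> - \<gamma>) * (1 + \<alpha>) powr (- (1 - \<theta>)) * (m powr (- (1 - \<theta>)) * F)"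
      using mult_right_mono[OF ba F(2)] by (simp only: mult.assoc)
    also have "\<dots> \<le> 6 powr (2 + \<alpha> - \<gamma>) * (1 + \<alpha>) powr (- (1 - \<theta>)) *
        (2 powr (p * \<theta>) * B powr \<kappa> * H powr \<theta> * r powr \<kappa>)"
      unfolding r_def using USm(1-3) FH UB F(3) by (intro mult_left_mono box_average_bound) auto
    also have "\<dots> = box_const * B powr \<kappa> * H powr \<theta> * r powr \<kappa>"
      by (simp only: box_const_def mult.assoc)
    finally have fin: "(b - a) powr - (2 + \<alpha> - \<gamma>) * F \<le> box_const * B powr \<kappa> * H powr \<theta> * r powr \<kappa>" .
    have c0: "0 \<le> box_const * B powr \<kappa> * H powr \<theta>" by (simp add: box_const_def)
    have "ennreal ((b - a) powr - (2 + \<alpha> - \<gamma>)) * wint \<alpha> (Qbox a b) (\<lambda>w. ennreal (norm (f w)))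
        \<le> ennreal ((b - a) powr - (2 + \<alpha> - \<gamma>)) * ennreal F"
      by (intro mult_left_mono wF) auto
    also have "\<dots> \<le> ennreal (box_const * B powr \<kappa> * H powr \<theta> * r powr \<kappa>)"
      using fin FH by (subst ennreal_mult[symmetric]) (auto intro: ennreal_leI)
    also have "\<dots> = ennreal (box_const * B powr \<kappa> * H powr \<theta>) * enpow (ennreal r) \<kappa>"
      using c0 r by (subst ennreal_mult) (auto simp: enpow_ennreal)
    also have "\<dots> \<le> ?R"
      using kappa_pos r_le by (intro mult_left_mono enpow_mono) auto
    finally show ?thesis .
  qed
qed

text \<open>Two strong-type bounds in succession, each in its own measure. They fit together because
  u (1 / u)^(q \<kappa>) = s and s (|f| / s)^p = (w |f|)^p.\<close>

lemma outer_max_bound: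
  assumes f [measurable]: "f \<in> borel_measurable borel"
  shows "(\<integral>\<^sup>+z. ennreal (w z powr q) * enpow (outer_max f t z) (q * \<kappa>) \<partial>hm \<alpha>)
    \<le> ennreal (lmax_const (q * \<kappa>) * lmax_const p) * (\<integral>\<^sup>+z. ennreal ((w z * norm (f z :: complex)) powr p) \<partial>hm \<alpha>)"
proof -
  have "(\<integral>\<^sup>+z. ennreal (w z powr q) * enpow (outer_max f t z) (q * \<kappa>) \<partial>hm \<alpha>)
      = (\<integral>\<^sup>+z. enpow (lmax mu_u (grid t) (inner_fun f t) z) (q * \<kappa>) \<partial>mu_u)"
    unfolding mu_u_def outer_max_def[unfolded mu_u_def, symmetric]
    by (subst nn_integral_density) auto
  also have "\<dots> \<le> ennreal (lmax_const (q * \<kappa>)) * (\<integral>\<^sup>+z. enpow (inner_fun f t z) (q * \<kappa>) \<partial>mu_u)"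
    by (intro lmax_strong_type grid_sets countable_grid laminar_grid q_kappa_gt_1) (simp cong: measurable_cong_sets)
  also have "(\<integral>\<^sup>+z. enpow (inner_fun f t z) (q * \<kappa>) \<partial>mu_u)
      = (\<integral>\<^sup>+z. enpow (inner_max f t z) p \<partial>mu_s)"
  proof -
    have "ennreal (w z powr q) * enpow (inner_fun f t z) (q * \<kappa>) = ennreal (w z powr (- p')) * enpow (inner_max f t z) p" for z
    proof -
      have "enpow (inner_fun f t z) (q * \<kappa>) = enpow (inner_max f t z) p * ennreal ((w z powr (- q)) powr (q * \<kappa>))"
        using q_kappa_gt_1 p w_pos[of z] kappa_pos q_pos
        by (simp add: inner_fun_def enpow_mult enpow_enpow enpow_ennreal del: powr_powr)
      moreover have "q + (- q) * (q * \<kappa>) = - p'" using q_kappa q_pos by (simp add: field_simps)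
      then have "w z powr q * (w z powr (- q)) powr (q * \<kappa>) = w z powr (- p')"
        using w_pos[of z] unfolding powr_powr powr_add[symmetric] by presburger
      then have "ennreal (w z powr q) * ennreal ((w z powr (- q)) powr (q * \<kappa>)) = ennreal (w z powr (- p'))"
        by (subst ennreal_mult[symmetric]) auto
      ultimately show ?thesis
        by (metis mult.assoc mult.commute)
    qed
    then show ?thesis unfolding mu_u_def mu_s_def by (subst (1 2) nn_integral_density) auto
  qed
  also have "\<dots> \<le> ennreal (lmax_const p) * (\<integral>\<^sup>+z. enpow (ennreal (norm (f z) * w z powr p')) p \<partial>mu_s)"
    unfolding inner_max_def
    by (intro lmax_strong_type grid_sets countable_grid laminar_grid p) (simp cong: measurable_cong_sets)
  also have "(\<integral>\<^sup>+z. enpow (ennreal (norm (f z) * w z powr p')) p \<partial>mu_s) = (\<integral>\<^sup>+z. ennreal ((w z * norm (f z)) powr p) \<partial>hm \<alpha>)"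
  proof -
    have "ennreal (w z powr (- p')) * enpow (ennreal (norm (f z) * w z powr p')) p = ennreal ((w z * norm (f z)) powr p)" for z
    proof -
      have "- p' + p' * p = p" using p'_mult by (simp add: algebra_simps)
      then have "w z powr (- p') * (norm (f z) * w z powr p') powr p = (w z * norm (f z)) powr p"
        by (simp only: powr_mult powr_powr) (metis mult.assoc mult.commute powr_add)
      then show ?thesis using p w_pos[of z] by (simp add: enpow_ennreal ennreal_mult''[symmetric])
    qed
    then show ?thesis unfolding mu_s_def by (subst nn_integral_density) auto
  qed
  finally show ?thesis using lmax_const_pos[OF p] lmax_const_pos[OF q_kappa_gt_1]
    by (simp add: ennreal_mult mult.assoc mult_left_mono)
qed

lemma B_pos: "0 < B"
proof -
  obtain U S m :: real where "0 < U" "0 < S" "0 < m" "U / m * (S / m) powr (q / p') \<le> B"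
    by (rule grid_box_mass[of 0 True 0])
  then show ?thesis by (smt (verit) divide_pos_pos mult_pos_pos powr_gt_zero)
qed

theorem weighted_bound:
  assumes f [measurable]: "f \<in> borel_measurable borel"
  shows "Lnorm q \<alpha> (\<lambda>z. ennreal (w z) * maxop \<alpha> \<gamma> f z)
    \<le> ennreal (strong_const * B powr \<kappa>) * Lnorm p \<alpha> (\<lambda>z. ennreal (w z * norm (f z)))"
proof -
  define Hn where "Hn = (\<integral>\<^sup>+z. ennreal ((w z * norm (f z)) powr p) \<partial>hm \<alpha>)"
  have "enpow (ennreal (w z * norm (f z))) p = ennreal ((w z * norm (f z)) powr p)" for z
    using w_pos[of z] p by (intro enpow_ennreal) auto
  then have Lp: "Lnorm p \<alpha> (\<lambda>z. ennreal (w z * norm (f z))) = enpow Hn (1 / p)"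
    unfolding Lnorm_def Hn_def by (subst nn_integral_hm) auto
  show ?thesis
  proof (cases Hn)
    case top
    \<comment> \<open>The right side is infinite; this relies on a positive constant, since 0 * top
      = 0.\<close>
    then show ?thesis using strong_const_pos B_pos p by (simp add: Lp ennreal_mult_top)
  next
    case (real H)
    define C where "C = box_const * B powr \<kappa> * H powr \<theta>"
    have C: "0 \<le> C" by (simp add: C_def box_const_def)
    define K where "K = lmax_const (q * \<kappa>) * lmax_const p"
    have K: "0 < K" using lmax_const_pos[OF p] lmax_const_pos[OF q_kappa_gt_1] by (simp add: K_def)
    have "enpow (ennreal (w z) * maxop \<alpha> \<gamma> f z) q \<le> ennreal (C powr q) *
        (ennreal (w z powr q) * enpow (outer_max f True z) (q * \<kappa>) +
         ennreal (w z powr q) * enpow (outer_max f False z) (q * \<kappa>))" for z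
    proof -
      have "enpow (ennreal (w z) * maxop \<alpha> \<gamma> f z) q = ennreal (w z powr q) * enpow (maxop \<alpha> \<gamma> f z) q"
        using q_pos w_pos[of z] by (simp add: enpow_mult enpow_ennreal)
      also have "\<dots> \<le> ennreal (w z powr q) * enpow (ennreal C * enpow (max (outer_max f True z) (outer_max f False z)) \<kappa>) q"
        using maxop_pointwise[OF f, of H z] real q_pos unfolding Hn_def C_def
        by (intro mult_left_mono enpow_mono) auto
      also have "\<dots> = ennreal (w z powr q) * (ennreal (C powr q) * enpow (max (outer_max f True z) (outer_max f False z)) (q * \<kappa>))"
        using q_pos kappa_pos C by (simp add: enpow_mult enpow_enpow enpow_ennreal mult.commute)
      also have "\<dots> \<le> ennreal (w z powr q) * (ennreal (C powr q) * (enpow (outer_max f True z) (q * \<kappa>) + enpow (outer_max f False z) (q * \<kappa>)))"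
        using q_pos kappa_pos by (intro mult_left_mono enpow_max_le) auto
      finally show ?thesis by (simp add: distrib_left ac_simps)
    qed
    then have "wint \<alpha> UH (\<lambda>z. enpow (ennreal (w z) * maxop \<alpha> \<gamma> f z) q)
      \<le> wint \<alpha> UH (\<lambda>z. ennreal (C powr q) *
        (ennreal (w z powr q) * enpow (outer_max f True z) (q * \<kappa>) +
         ennreal (w z powr q) * enpow (outer_max f False z) (q * \<kappa>)))"
      unfolding wint_def by (intro nn_integral_mono mult_left_mono) auto
    also have "\<dots> = ennreal (C powr q) *
       ((\<integral>\<^sup>+z. ennreal (w z powr q) * enpow (outer_max f True z) (q * \<kappa>) \<partial>hm \<alpha>) +
        (\<integral>\<^sup>+z. ennreal (w z powr q) * enpow (outer_max f False z) (q * \<kappa>) \<partial>hm \<alpha>))"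
      by (subst nn_integral_hm[symmetric]) (auto simp: nn_integral_cmult nn_integral_add)
    also have "\<dots> \<le> ennreal (C powr q) * (ennreal K * ennreal H + ennreal K * ennreal H)"
      using outer_max_bound[OF f] real by (intro mult_left_mono add_mono) (auto simp: Hn_def K_def)
    also have "\<dots> = ennreal (C powr q * (2 * K) * H)"
      using K real by (simp add: ennreal_mult mult_2[symmetric] mult.assoc)
    finally have "Lnorm q \<alpha> (\<lambda>z. ennreal (w z) * maxop \<alpha> \<gamma> f z) \<le> enpow (ennreal (C powr q * (2 * K) * H)) (1 / q)"
      unfolding Lnorm_def using q_pos by (intro enpow_mono) auto
    also have "\<dots> = ennreal ((C powr q * (2 * K) * H) powr (1 / q))"
      using K real q_pos by (intro enpow_ennreal) auto
    also have "(C powr q * (2 * K) * H) powr (1 / q) = C * (2 * K) powr (1 / q) * H powr (1 / q)"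
      using q_pos C by (simp only: powr_mult powr_powr) simp
    also have "\<dots> = strong_const * B powr \<kappa> * H powr (1 / p)"
    proof -
      \<comment> \<open>The H^\<theta> spent on the boxes and the H^(1 / q) from the norm recombine,
        as \<theta> + 1 / q = 1 / p.\<close>
      have "H powr (1 / p) = H powr \<theta> * H powr (1 / q)"
        unfolding powr_add[symmetric] inverse_q by simp
      then show ?thesis by (simp add: C_def strong_const_def K_def)
    qed
    finally show ?thesis using real p strong_const_pos by (simp add: Lp enpow_ennreal ennreal_mult)
  qed
qed

end

section \<open>Weights with zeros\<close>

text \<open>A weight is unconstrained off the half-plane, so integrands are exchanged up to null
  sets inside \<open>wint\<close> before any measurability is claimed.\<close>

lemma wint_cong_AE:
  assumes "AE z in hm \<alpha>. z \<in> A \<longrightarrow> g z = h z" "A \<subseteq> UH"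
  shows "wint \<alpha> A g = wint \<alpha> A h"
proof -
  have "AE z in lborel. 0 < indicator UH z * ennreal (Im z powr \<alpha>) \<longrightarrow> z \<in> A \<longrightarrow> g z = h z"
    using assms(1) unfolding hm_def by (subst (asm) AE_density) auto
  then have "AE z in lborel. indicator A z * ennreal (Im z powr \<alpha>) * g z = indicator A z * ennreal (Im z powr \<alpha>) * h z"
    by (rule AE_mp) (rule AE_I2, use assms(2) in \<open>auto simp: UH_def split: split_indicator\<close>)
  then show ?thesis unfolding wint_def by (rule nn_integral_cong_AE)
qed

text \<open>Local integrability makes every truncation to a compact set measurable, and the compact
  sets K n exhaust the half-plane. The indicator removes the unknown values off
  \<open>UH\<close>.\<close>

lemma weight_measurable:
  assumes "weight \<omega>"
  shows "(\<lambda>z. indicator UH z * \<omega> z) \<in> borel_measurable borel"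
proof -
  define K where "K n = cball 0 (real n) \<inter> {z. 1 / real (Suc n) \<le> Im z}" for n
  have K: "compact (K n)" "K n \<subseteq> UH" for n
  proof -
    have "closed {z. 1 / real (Suc n) \<le> Im z}" by (intro closed_Collect_le continuous_intros)
    then show "compact (K n)" unfolding K_def by (intro compact_Int_closed) auto
    show "K n \<subseteq> UH"
    proof
      fix z assume "z \<in> K n"
      then have "1 / real (Suc n) \<le> Im z" by (simp add: K_def)
      moreover have "0 < 1 / real (Suc n)" by simp
      ultimately show "z \<in> UH" unfolding UH_def by (simp only: mem_Collect_eq)
    qed
  qed
  have m: "(\<lambda>z. indicator (K n) z * \<omega> z) \<in> borel_measurable borel" for n
    using assms K[of n] unfolding weight_def set_integrable_def by auto
  show ?thesis
  proof (rule borel_measurable_LIMSEQ_real[OF _ m])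
    fix z :: complex
    show "(\<lambda>n. indicator (K n) z * \<omega> z) \<longlonglongrightarrow> indicator UH z * \<omega> z"
    proof (cases "z \<in> UH")
      case True
      then have "0 < Im z" by (simp add: UH_def)
      then obtain n1 where n1: "inverse (real (Suc n1)) < Im z" using reals_Archimedean by blast
      obtain n2 where n2: "norm z \<le> real n2" using real_arch_simple by blast
      have "z \<in> K n" if "max n1 n2 \<le> n" for n
      proof -
        have "1 / real (Suc n) \<le> 1 / real (Suc n1)" using that by (simp add: frac_le)
        then show ?thesis using n1 n2 that by (auto simp: K_def inverse_eq_divide)
      qed
      then have "\<forall>\<^sub>F n in sequentially. indicator (K n) z * \<omega> z = indicator UH z * \<omega> z"
        using True by (auto simp: eventually_sequentially intro!: exI[of _ "max n1 n2"])
      then show ?thesis by (rule tendsto_eventually)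
    next
      case False
      then have "indicator (K n) z = (0::real)" for n using K(2)[of n] by (auto simp: indicator_def)
      then show ?thesis using False by simp
    qed
  qed
qed

lemma enpow_neg_zero: "s < 0 \<Longrightarrow> enpow 0 s = top"
  by (simp add: enpow_def)

lemma UH_eq_UN_Qbox: "UH = (\<Union>n::nat. Qbox (- real (Suc n)) (real (Suc n)))"
proof -
  have "\<exists>n::nat. z \<in> Qbox (- real (Suc n)) (real (Suc n))" if "z \<in> UH" for z
  proof -
    obtain n :: nat where "norm z \<le> real n" using real_arch_simple by blast
    then have "\<bar>Re z\<bar> \<le> real n" "\<bar>Im z\<bar> \<le> real n"
      using abs_Re_le_cmod[of z] abs_Im_le_cmod[of z] by linarith+
    then have "z \<in> Qbox (- real (Suc n)) (real (Suc n))"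
      using that unfolding Qbox_def UH_def by (auto simp: abs_le_iff)
    then show ?thesis ..
  qed
  then show ?thesis using Qbox_subset_UH by (intro equalityI subsetI) auto
qed

context off_diagonal
begin

lemma Bchar_ge:
  assumes "a < b"
  shows "wint \<alpha> (Qbox a b) (\<lambda>z. enpow (ennreal (\<omega> z)) q) / Qmeas \<alpha> a b *
    enpow (wint \<alpha> (Qbox a b) (\<lambda>z. enpow (ennreal (\<omega> z)) (- p')) / Qmeas \<alpha> a b) (q / p') \<le> Bchar p q \<alpha> \<omega>"
  unfolding Bchar_def p'_def by (rule SUP_upper2[of "(a, b)"]) (use assms in auto)

text \<open>A finite characteristic forbids vanishing on a set of positive measure, except for the zero weight, where
  \<open>0 * top = 0\<close> makes the characteristic 0.\<close>

lemma weight_dichotomy: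
  assumes "weight \<omega>" "Bchar p q \<alpha> \<omega> < top"
  shows "(AE z in hm \<alpha>. z \<in> UH \<longrightarrow> \<omega> z = 0) \<or> (AE z in hm \<alpha>. z \<in> UH \<longrightarrow> 0 < \<omega> z)"
proof -
  define W where "W z = ennreal (indicator UH z * \<omega> z)" for z
  have W [measurable]: "W \<in> borel_measurable borel"
    unfolding W_def using weight_measurable[OF assms(1)] by measurable
  have nonneg: "0 \<le> \<omega> z" if "z \<in> UH" for z using assms(1) that by (simp add: weight_def)
  define Q where "Q n = Qbox (- real (Suc n)) (real (Suc n))" for n
  have Q [measurable]: "Q n \<in> sets borel" and Q_sub: "Q n \<subseteq> UH" for n by (auto simp: Q_def Qbox_subset_UH)
  have Q_mono: "Q m \<subseteq> Q n" if "m \<le> n" for m n using that by (auto simp: Q_def Qbox_def)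
  have int: "wint \<alpha> (Q n) (\<lambda>z. enpow (ennreal (\<omega> z)) s) = (\<integral>\<^sup>+z\<in>Q n. enpow (W z) s \<partial>hm \<alpha>)" for s n
  proof -
    have "wint \<alpha> (Q n) (\<lambda>z. enpow (ennreal (\<omega> z)) s) = wint \<alpha> (Q n) (\<lambda>z. enpow (W z) s)"
      using Q_sub[of n] by (intro wint_cong_AE AE_I2) (auto simp: W_def)
    then show ?thesis using Q_sub by (subst (asm) (2) wint_eq_nn_integral_hm) auto
  qed
  have m: "Qmeas \<alpha> (- real (Suc n)) (real (Suc n)) = ennreal ((real (Suc n) + real (Suc n)) powr (2 + \<alpha>) / (1 + \<alpha>))" for n
    using Qmeas_eq[OF alpha, of "- real (Suc n)" "real (Suc n)"] by simp
  show ?thesis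
  proof (cases "\<forall>n. (\<integral>\<^sup>+z\<in>Q n. enpow (W z) q \<partial>hm \<alpha>) = 0")
    case True
    have "AE z in hm \<alpha>. z \<in> Q n \<longrightarrow> W z = 0" for n
    proof -
      have "AE z in hm \<alpha>. enpow (W z) q * indicator (Q n) z = 0"
        using True by (subst nn_integral_0_iff_AE[symmetric]) auto
      moreover have "W z = 0" if "enpow (W z) q = 0" for z
        using that q_pos by (cases "W z") (auto simp: enpow_ennreal split: if_splits)
      ultimately show ?thesis by (auto simp: indicator_def elim!: AE_mp)
    qed
    then have "AE z in hm \<alpha>. \<forall>n. z \<in> Q n \<longrightarrow> W z = 0" by (subst AE_all_countable) auto
    then have "AE z in hm \<alpha>. z \<in> UH \<longrightarrow> \<omega> z = 0"
      by (rule AE_mp) (rule AE_I2, use nonneg in \<open>auto simp: W_def UH_eq_UN_Qbox Q_def ennreal_eq_0_iff dest!: antisym\<close>)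
    then show ?thesis ..
  next
    case False
    then obtain n0 where n0: "(\<integral>\<^sup>+z\<in>Q n0. enpow (W z) q \<partial>hm \<alpha>) \<noteq> 0" by blast
    \<comment> \<open>From n0 on the first factor of the characteristic is nonzero, so the second
      must be finite.\<close>
    have "AE z in hm \<alpha>. z \<in> Q n \<longrightarrow> W z \<noteq> 0" if "n0 \<le> n" for n
    proof -
      define X Y where "X = (\<integral>\<^sup>+z\<in>Q n. enpow (W z) q \<partial>hm \<alpha>)" and "Y = (\<integral>\<^sup>+z\<in>Q n. enpow (W z) (- p') \<partial>hm \<alpha>)"
      define c where "c = (real (Suc n) + real (Suc n)) powr (2 + \<alpha>) / (1 + \<alpha>)"
      have c: "0 < c" using alpha by (simp add: c_def)
      have e: "0 < q / p'" using q_pos p'_gt_1 by simp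
      have "(\<integral>\<^sup>+z\<in>Q n0. enpow (W z) q \<partial>hm \<alpha>) \<le> X"
        unfolding X_def using Q_mono[OF that] by (intro nn_integral_mono) (auto split: split_indicator)
      then have X: "X \<noteq> 0" using n0 by auto
      have "X / ennreal c * enpow (Y / ennreal c) (q / p') \<le> Bchar p q \<alpha> \<omega>"
        using Bchar_ge[of "- real (Suc n)" "real (Suc n)" \<omega>] m[of n]
        unfolding X_def Y_def int[symmetric] unfolding Q_def c_def by simp
      then have fin: "X / ennreal c * enpow (Y / ennreal c) (q / p') < top" using assms(2) by (rule le_less_trans)
      have "Y \<noteq> top"
      proof
        assume "Y = top"
        then have "X / ennreal c * top < top" using fin e by (simp add: ennreal_top_divide)
        moreover have "X / ennreal c \<noteq> 0" using X by (simp add: ennreal_divide_eq_0_iff)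
        ultimately show False by (simp add: ennreal_mult_top)
      qed
      \<comment> \<open>At a zero of W the power -p' is \<open>top\<close>; a finite integral
        confines these points to a null set.\<close>
      then have "AE z in hm \<alpha>. enpow (W z) (- p') * indicator (Q n) z \<noteq> \<infinity>"
        by (intro nn_integral_noteq_infinite) (auto simp: Y_def)
      then show ?thesis
        by (rule AE_mp) (rule AE_I2, use p'_gt_1 in \<open>auto simp: enpow_neg_zero\<close>)
    qed
    then have "AE z in hm \<alpha>. \<forall>n. n0 \<le> n \<longrightarrow> z \<in> Q n \<longrightarrow> W z \<noteq> 0"
      by (subst AE_all_countable) auto
    then have "AE z in hm \<alpha>. z \<in> UH \<longrightarrow> 0 < \<omega> z"
    proof (rule AE_mp, intro AE_I2 impI)
      fix z assume W0: "\<forall>n\<ge>n0. z \<in> Q n \<longrightarrow> W z \<noteq> 0" and z: "z \<in> UH"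
      then obtain n where "z \<in> Q n" by (auto simp: UH_eq_UN_Qbox Q_def)
      then have "z \<in> Q (max n n0)" using Q_mono[of n "max n n0"] by auto
      then have "W z \<noteq> 0" using W0[rule_format, OF max.cobounded2] by blast
      then show "0 < \<omega> z" using z nonneg[OF z] by (auto simp: W_def less_le)
    qed
    then show ?thesis ..
  qed
qed

theorem maximal_bound:
  assumes "weight \<omega>" "Bchar p q \<alpha> \<omega> < top" and f: "f \<in> borel_measurable borel"
  shows "Lnorm q \<alpha> (\<lambda>z. ennreal (\<omega> z) * maxop \<alpha> \<gamma> f z)
    \<le> ennreal strong_const * enpow (Bchar p q \<alpha> \<omega>) \<kappa> * Lnorm p \<alpha> (\<lambda>z. ennreal (\<omega> z * norm (f z)))"
  using weight_dichotomy[OF assms(1,2)]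
proof
  assume "AE z in hm \<alpha>. z \<in> UH \<longrightarrow> \<omega> z = 0"
  then have "AE z in hm \<alpha>. z \<in> UH \<longrightarrow> enpow (ennreal (\<omega> z) * maxop \<alpha> \<gamma> f z) q = 0"
    by (rule AE_mp) (use q_pos in auto)
  then have "wint \<alpha> UH (\<lambda>z. enpow (ennreal (\<omega> z) * maxop \<alpha> \<gamma> f z) q) = wint \<alpha> UH (\<lambda>z. 0)"
    by (rule wint_cong_AE) auto
  then show ?thesis using q_pos by (simp add: Lnorm_def wint_def)
next
  assume pos: "AE z in hm \<alpha>. z \<in> UH \<longrightarrow> 0 < \<omega> z"
  \<comment> \<open>The value 1 off the half-plane and at the zeros changes the weight only on a
    null set of \<open>hm\<close> and makes it positive and Borel everywhere.\<close>
  define w where "w z = (if 0 < indicator UH z * \<omega> z then indicator UH z * \<omega> z else 1)" for z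
  define B where "B = enn2real (Bchar p q \<alpha> \<omega>)"
  have B: "Bchar p q \<alpha> \<omega> = ennreal B" using assms(2) by (simp add: B_def)
  have w_pos: "0 < w z" for z by (simp add: w_def)
  have w_meas [measurable]: "w \<in> borel_measurable borel"
    unfolding w_def using weight_measurable[OF assms(1)] by measurable
  have eq: "AE z in hm \<alpha>. z \<in> UH \<longrightarrow> w z = \<omega> z"
    using pos by (rule AE_mp) (auto simp: w_def)
  have int: "wint \<alpha> (Qbox a b) (\<lambda>z. enpow (ennreal (\<omega> z)) s) = (\<integral>\<^sup>+z\<in>Qbox a b. ennreal (w z powr s) \<partial>hm \<alpha>)" for s a b
  proof -
    have "wint \<alpha> (Qbox a b) (\<lambda>z. enpow (ennreal (\<omega> z)) s) = wint \<alpha> (Qbox a b) (\<lambda>z. ennreal (w z powr s))"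
    proof (rule wint_cong_AE)
      have *: "enpow (ennreal (w z)) s = ennreal (w z powr s)" for z using w_pos by (intro enpow_ennreal) auto
      show "AE z in hm \<alpha>. z \<in> Qbox a b \<longrightarrow> enpow (ennreal (\<omega> z)) s = ennreal (w z powr s)"
      proof (rule AE_mp[OF eq], intro AE_I2 impI)
        fix z assume "z \<in> UH \<longrightarrow> w z = \<omega> z" "z \<in> Qbox a b"
        then have "w z = \<omega> z" using Qbox_subset_UH by blast
        then show "enpow (ennreal (\<omega> z)) s = ennreal (w z powr s)" using *[of z] by simp
      qed
    qed (rule Qbox_subset_UH)
    then show ?thesis by (simp add: wint_eq_nn_integral_hm Qbox_subset_UH)
  qed
  interpret off_diagonal_weight \<alpha> \<gamma> p q w B
  proof
    fix a b :: real assume "a < b"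
    then show "(\<integral>\<^sup>+z\<in>Qbox a b. ennreal (w z powr q) \<partial>hm \<alpha>) / emeasure (hm \<alpha>) (Qbox a b) *
      enpow ((\<integral>\<^sup>+z\<in>Qbox a b. ennreal (w z powr (- p')) \<partial>hm \<alpha>) / emeasure (hm \<alpha>) (Qbox a b)) (q / p') \<le> ennreal B"
      using Bchar_ge[of a b \<omega>] unfolding int B by (simp add: Qmeas_eq emeasure_hm_Qbox alpha)
  qed (auto simp: w_pos)
  have Lnorm_eq: "Lnorm r \<alpha> (\<lambda>z. h (\<omega> z) z) = Lnorm r \<alpha> (\<lambda>z. h (w z) z)" for r h
  proof -
    have "AE z in hm \<alpha>. z \<in> UH \<longrightarrow> enpow (h (\<omega> z) z) r = enpow (h (w z) z) r"
      by (rule AE_mp[OF eq]) auto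
    then show ?thesis unfolding Lnorm_def by (simp add: wint_cong_AE)
  qed
  have "Lnorm q \<alpha> (\<lambda>z. ennreal (\<omega> z) * maxop \<alpha> \<gamma> f z) = Lnorm q \<alpha> (\<lambda>z. ennreal (w z) * maxop \<alpha> \<gamma> f z)"
    by (rule Lnorm_eq)
  also have "\<dots> \<le> ennreal (strong_const * B powr \<kappa>) * Lnorm p \<alpha> (\<lambda>z. ennreal (w z * norm (f z)))"
    by (rule weighted_bound[OF f])
  also have "Lnorm p \<alpha> (\<lambda>z. ennreal (w z * norm (f z))) = Lnorm p \<alpha> (\<lambda>z. ennreal (\<omega> z * norm (f z)))"
    by (rule Lnorm_eq[symmetric])
  also have "ennreal (strong_const * B powr \<kappa>) = ennreal strong_const * enpow (Bchar p q \<alpha> \<omega>) \<kappa>"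
    using B B_pos strong_const_pos by (simp add: enpow_ennreal ennreal_mult)
  finally show ?thesis .
qed

end

section \<open>Power weights and sharpness\<close>

definition box_gauge :: "complex \<Rightarrow> real" where
  "box_gauge z = max \<bar>Re z\<bar> \<bar>Im z\<bar>"

text \<open>The upper half of a sup-norm ball: a rectangle of width 2 r and height r, whose mass is
  explicit and scales exactly like r^(2 + \<alpha>).\<close>

definition gauge_box :: "real \<Rightarrow> complex set" where
  "gauge_box r = {z \<in> UH. box_gauge z < r}"

lemma gauge_measurable [measurable]: "box_gauge \<in> borel_measurable borel"
  unfolding box_gauge_def by measurable

lemma gauge_nonneg [simp]: "0 \<le> box_gauge z"
  by (simp add: box_gauge_def le_max_iff_disj)

lemma gauge_pos: "z \<in> UH \<Longrightarrow> 0 < box_gauge z"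
  by (auto simp: box_gauge_def UH_def less_max_iff_disj)

lemma gauge_box_borel [measurable]: "gauge_box r \<in> sets borel"
  unfolding gauge_box_def by measurable

lemma gauge_box_subset_UH: "gauge_box r \<subseteq> UH"
  by (auto simp: gauge_box_def)

lemma gauge_box_mono: "r \<le> s \<Longrightarrow> gauge_box r \<subseteq> gauge_box s"
  by (auto simp: gauge_box_def)

lemma gauge_box_eq: "gauge_box r = {z. Re z \<in> {- r<..<r} \<and> 0 < Im z \<and> Im z < r}"
  by (auto simp: gauge_box_def box_gauge_def UH_def)

lemma emeasure_hm_gauge_box:
  assumes "-1 < \<alpha>" "0 < r"
  shows "emeasure (hm \<alpha>) (gauge_box r) = ennreal (2 / (1 + \<alpha>) * r powr (2 + \<alpha>))"
proof -
  have "emeasure (hm \<alpha>) (gauge_box r) = ennreal (r powr (\<alpha> + 1) / (\<alpha> + 1)) * ennreal (r - (- r))"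
    unfolding gauge_box_eq using emeasure_hm_rectangle[of \<alpha> r "{- r<..<r}"] assms by simp
  also have "\<dots> = ennreal (2 / (1 + \<alpha>) * (r powr (1 + \<alpha>) * r))"
    using assms by (subst ennreal_mult''[symmetric]) (auto simp: add.commute)
  finally show ?thesis using assms by (simp add: powr_square_height add.commute)
qed

section \<open>Dyadic shells and integrals of powers of the gauge\<close>

definition shell :: "real \<Rightarrow> nat \<Rightarrow> complex set" where
  "shell r k = gauge_box (r / 2 ^ k) - gauge_box (r / 2 ^ Suc k)"

lemma shell_borel [measurable]: "shell r k \<in> sets borel"
  unfolding shell_def by measurable

lemma disjoint_shell:
  assumes "0 < r" shows "disjoint_family (shell r)"
  unfolding disjoint_family_on_def
proof (intro ballI impI)
  have *: "shell r i \<inter> shell r j = {}" if "i < j" for i j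
  proof -
    have "r / 2 ^ j \<le> r / 2 ^ Suc i"
      using that assms by (intro divide_left_mono power_increasing) auto
    then show ?thesis using gauge_box_mono[of "r / 2 ^ j" "r / 2 ^ Suc i"] unfolding shell_def by blast
  qed
  fix i j :: nat assume "i \<noteq> j"
  then show "shell r i \<inter> shell r j = {}" using *[of i j] *[of j i] by (cases i j rule: linorder_cases) auto
qed

lemma gauge_box_eq_UN_shell:
  assumes "0 < r" shows "gauge_box r = (\<Union>k. shell r k)"
proof (intro equalityI subsetI)
  fix z assume z: "z \<in> gauge_box r"
  then have g: "0 < box_gauge z" "box_gauge z < r" by (auto simp: gauge_box_def gauge_pos)
  obtain n where "r / box_gauge z < 2 ^ n" using real_arch_pow[of 2 "r / box_gauge z"] by auto
  then have "r / 2 ^ n \<le> box_gauge z" using g by (simp add: field_simps)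
  then have ex: "\<exists>n. r / 2 ^ n \<le> box_gauge z" ..
  \<comment> \<open>n0 is at least 1 because the gauge is below r; its predecessor indexes the shell
    of z.\<close>
  define n0 where "n0 = (LEAST n. r / 2 ^ n \<le> box_gauge z)"
  have n0: "r / 2 ^ n0 \<le> box_gauge z" unfolding n0_def by (rule LeastI_ex[OF ex])
  then obtain k where k: "n0 = Suc k" using g by (cases n0) auto
  have "\<not> r / 2 ^ k \<le> box_gauge z" using not_less_Least[of k "\<lambda>n. r / 2 ^ n \<le> box_gauge z"] k by (simp add: n0_def)
  then have "z \<in> shell r k" using n0 k z by (auto simp: shell_def gauge_box_def)
  then show "z \<in> (\<Union>k. shell r k)" by blast
next
  fix z assume "z \<in> (\<Union>k. shell r k)"
  then obtain k where "z \<in> gauge_box (r / 2 ^ k)" by (auto simp: shell_def)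
  moreover have "r / 2 ^ k \<le> r" using assms by (simp add: divide_le_eq)
  ultimately show "z \<in> gauge_box r" using gauge_box_mono by blast
qed

lemma emeasure_hm_shell:
  assumes "-1 < \<alpha>" "0 < r"
  shows "emeasure (hm \<alpha>) (shell r k) = ennreal (2 / (1 + \<alpha>) * (1 - 2 powr (- (2 + \<alpha>))) * (r / 2 ^ k) powr (2 + \<alpha>))"
proof -
  have sub: "gauge_box (r / 2 ^ Suc k) \<subseteq> gauge_box (r / 2 ^ k)"
    using assms by (intro gauge_box_mono divide_left_mono) auto
  have "emeasure (hm \<alpha>) (shell r k) = emeasure (hm \<alpha>) (gauge_box (r / 2 ^ k)) - emeasure (hm \<alpha>) (gauge_box (r / 2 ^ Suc k))"
    unfolding shell_def using sub assms
    by (intro emeasure_Diff) (auto simp: emeasure_hm_gauge_box)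
  also have "\<dots> = ennreal (2 / (1 + \<alpha>) * (r / 2 ^ k) powr (2 + \<alpha>) - 2 / (1 + \<alpha>) * (r / 2 ^ Suc k) powr (2 + \<alpha>))"
    using assms by (subst (1 2) emeasure_hm_gauge_box) (auto simp: ennreal_minus)
  also have "(r / 2 ^ Suc k) powr (2 + \<alpha>) = (r / 2 ^ k) powr (2 + \<alpha>) * 2 powr (- (2 + \<alpha>))"
  proof -
    have "r / 2 ^ Suc k = r / 2 ^ k * inverse 2" by simp
    moreover have "inverse (2::real) powr (2 + \<alpha>) = 2 powr (- (2 + \<alpha>))"
      by (simp only: inverse_powr powr_minus)
    ultimately show ?thesis by (simp only: powr_mult)
  qed
  finally show ?thesis by (simp add: algebra_simps)
qed

lemma geometric_powr_sums:
  fixes r \<eta> :: real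
  assumes "0 < r" "0 < \<eta>"
  shows "(\<lambda>k. (r / 2 ^ k) powr \<eta>) sums (r powr \<eta> / (1 - 2 powr (- \<eta>)))"
proof -
  have "(r / 2 ^ k) powr \<eta> = r powr \<eta> * (2 powr (- \<eta>)) ^ k" for k
  proof -
    have "(2 powr (- \<eta>)) ^ k = 2 powr (- \<eta> * real k)"
      by (simp add: powr_realpow[symmetric] powr_powr)
    also have "\<dots> = (2 powr real k) powr (- \<eta>)" by (simp only: powr_powr mult.commute)
    also have "\<dots> = inverse ((2 ^ k) powr \<eta>)" by (simp only: powr_minus powr_realpow zero_less_numeral)
    finally show ?thesis by (simp only: divide_inverse powr_mult inverse_powr)
  qed
  moreover have "(\<lambda>k. r powr \<eta> * (2 powr (- \<eta>)) ^ k) sums (r powr \<eta> * (1 / (1 - 2 powr (- \<eta>))))"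
    using two_powr_neg_less_one[OF assms(2)] by (intro sums_mult geometric_sums) auto
  ultimately show ?thesis by simp
qed

text \<open>From exp x \<ge> 1 + x and 1 / 2 \<le> ln 2 \<le> 1. Bounds linear in \<eta> make the
  geometric sums of order exactly 1 / \<eta>, the source of all blow-up below.\<close>

lemma one_minus_two_powr:
  fixes \<eta> :: real
  assumes "0 < \<eta>"
  shows "1 - 2 powr (- \<eta>) \<le> \<eta>" and "\<eta> \<le> 1 \<Longrightarrow> \<eta> / 4 \<le> 1 - 2 powr (- \<eta>)"
proof -
  have ln2: "1 / 2 \<le> ln (2::real)" "ln (2::real) \<le> 1"
    using ln_2_less_1 ln_le_minus_one[of "1/2 :: real"] by (auto simp: ln_div)
  have "1 + (- \<eta>) * ln 2 \<le> 2 powr (- \<eta>)"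
    using exp_ge_add_one_self[of "- \<eta> * ln 2"] by (simp add: powr_def)
  moreover have "\<eta> * ln 2 \<le> \<eta>" using assms ln2 by (simp add: mult_left_le)
  ultimately show "1 - 2 powr (- \<eta>) \<le> \<eta>" by simp
  assume "\<eta> \<le> 1"
  have "1 + \<eta> / 2 \<le> 1 + \<eta> * ln 2" using assms mult_left_mono[OF ln2(1), of \<eta>] by simp
  also have "\<dots> \<le> 2 powr \<eta>"
    using exp_ge_add_one_self[of "\<eta> * ln 2"] by (simp add: powr_def)
  finally have "inverse (2 powr \<eta>) \<le> inverse (1 + \<eta> / 2)" using assms by (intro le_imp_inverse_le) auto
  also have "\<dots> \<le> 1 - \<eta> / 4" using assms \<open>\<eta> \<le> 1\<close> by (simp add: field_simps)
  finally show "\<eta> / 4 \<le> 1 - 2 powr (- \<eta>)" by (simp add: powr_minus)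
qed

text \<open>With d = 2 + \<alpha>, on the k-th shell the integrand is comparable to (r /
  2^k)^(\<eta> - d) and the mass to (r / 2^k)^d. The shells therefore sum to a multiple of r^\<eta>
  / (1 - 2^(-\<eta>)).\<close>

lemma gauge_integral:
  assumes "-1 < \<alpha>" "0 < r" "0 < \<eta>" "\<eta> \<le> 1"
  defines "I \<equiv> (\<integral>\<^sup>+z\<in>gauge_box r. ennreal (box_gauge z powr (\<eta> - (2 + \<alpha>))) \<partial>hm \<alpha>)"
  shows gauge_integral_le: "I \<le> ennreal (2 / (1 + \<alpha>) * 2 powr (4 + \<alpha>) * r powr \<eta> / \<eta>)"
    and gauge_integral_ge: "ennreal (2 / (1 + \<alpha>) * (1 - 2 powr (- (2 + \<alpha>))) * r powr \<eta> / \<eta>) \<le> I"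
proof -
  define d where "d = 2 + \<alpha>"
  have d: "1 < d" using assms by (simp add: d_def)
  define c where "c = 2 / (1 + \<alpha>) * (1 - 2 powr (- d))"
  have c: "0 \<le> c" "c \<le> 2 / (1 + \<alpha>)"
  proof -
    have e: "0 \<le> 1 - 2 powr (- d)" "1 - 2 powr (- d) \<le> 1" "0 < 2 / (1 + \<alpha>)"
      using two_powr_neg_less_one[of d] d assms(1) by auto
    show "0 \<le> c" unfolding c_def using e by (intro mult_nonneg_nonneg) auto
    show "c \<le> 2 / (1 + \<alpha>)" unfolding c_def using e mult_left_le[of "1 - 2 powr (- d)" "2 / (1 + \<alpha>)"] by simp
  qed
  have I_eq: "I = (\<Sum>k. (\<integral>\<^sup>+z\<in>shell r k. ennreal (box_gauge z powr (\<eta> - d)) \<partial>hm \<alpha>))"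
    unfolding I_def d_def gauge_box_eq_UN_shell[OF assms(2)]
    by (intro nn_integral_disjoint_family disjoint_shell assms) auto
  have shell_bounds: "r / 2 ^ Suc k \<le> box_gauge z" "box_gauge z < r / 2 ^ k" if "z \<in> shell r k" for z k
    using that by (auto simp: shell_def gauge_box_def)
  \<comment> \<open>The exponent \<eta> - d is negative, so the inner radius of a shell bounds the
    integrand from above.\<close>
  have "I \<le> (\<Sum>k. ennreal ((r / 2 ^ Suc k) powr (\<eta> - d)) * emeasure (hm \<alpha>) (shell r k))"
    unfolding I_eq
  proof (intro suminf_le allI)
    fix k
    have "(\<integral>\<^sup>+z\<in>shell r k. ennreal (box_gauge z powr (\<eta> - d)) \<partial>hm \<alpha>)
      \<le> (\<integral>\<^sup>+z. ennreal ((r / 2 ^ Suc k) powr (\<eta> - d)) * indicator (shell r k) z \<partial>hm \<alpha>)"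
    proof (intro nn_integral_mono)
      fix z
      show "ennreal (box_gauge z powr (\<eta> - d)) * indicator (shell r k) z \<le> ennreal ((r / 2 ^ Suc k) powr (\<eta> - d)) * indicator (shell r k) z"
      proof (cases "z \<in> shell r k")
        case True
        then show ?thesis using shell_bounds[OF True] assms d
          by (auto intro!: ennreal_leI powr_mono2')
      qed simp
    qed
    then show "(\<integral>\<^sup>+z\<in>shell r k. ennreal (box_gauge z powr (\<eta> - d)) \<partial>hm \<alpha>)
      \<le> ennreal ((r / 2 ^ Suc k) powr (\<eta> - d)) * emeasure (hm \<alpha>) (shell r k)"
      by (simp add: nn_integral_cmult_indicator)
  qed auto
  also have "\<dots> = (\<Sum>k. ennreal (c * 2 powr (d - \<eta>) * (r / 2 ^ k) powr \<eta>))"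
  proof (intro suminf_cong)
    fix k
    have "(r / 2 ^ Suc k) powr (\<eta> - d) = (r / 2 ^ k) powr (\<eta> - d) * 2 powr (d - \<eta>)"
    proof -
      have "r / 2 ^ Suc k = r / 2 ^ k * inverse 2" by simp
      moreover have "inverse (2::real) powr (\<eta> - d) = 2 powr (d - \<eta>)"
        by (simp only: inverse_powr powr_minus[symmetric] minus_diff_eq)
      ultimately show ?thesis by (simp only: powr_mult)
    qed
    moreover have e: "(r / 2 ^ k) powr \<eta> = (r / 2 ^ k) powr (\<eta> - d) * (r / 2 ^ k) powr d"
      by (simp add: powr_add[symmetric])
    ultimately have "(r / 2 ^ Suc k) powr (\<eta> - d) * (c * (r / 2 ^ k) powr d) = c * 2 powr (d - \<eta>) * (r / 2 ^ k) powr \<eta>"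
      by (simp only: e ac_simps)
    then show "ennreal ((r / 2 ^ Suc k) powr (\<eta> - d)) * emeasure (hm \<alpha>) (shell r k) = ennreal (c * 2 powr (d - \<eta>) * (r / 2 ^ k) powr \<eta>)"
      using assms c unfolding emeasure_hm_shell[OF assms(1,2)] c_def[symmetric] d_def[symmetric]
      by (subst ennreal_mult[symmetric]) auto
  qed
  also have "\<dots> = ennreal (c * 2 powr (d - \<eta>) * (r powr \<eta> / (1 - 2 powr (- \<eta>))))"
    using c assms by (intro suminf_ennreal_eq sums_mult geometric_powr_sums) auto
  \<comment> \<open>The constant 2^(4 + \<alpha>) is 4 * 2^d: the 4 from 1 - 2^(-\<eta>) \<ge>
    \<eta> / 4, the rest from 2^(d - \<eta>) \<le> 2^d.\<close>
  also have "\<dots> \<le> ennreal (2 / (1 + \<alpha>) * 2 powr (4 + \<alpha>) * r powr \<eta> / \<eta>)"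
  proof (rule ennreal_leI)
    have "2 powr (d - \<eta>) \<le> 2 powr d" using assms by (intro powr_mono) auto
    then have "c * 2 powr (d - \<eta>) \<le> 2 / (1 + \<alpha>) * 2 powr d" using c assms by (intro mult_mono) auto
    moreover have "r powr \<eta> / (1 - 2 powr (- \<eta>)) \<le> r powr \<eta> / (\<eta> / 4)"
      using one_minus_two_powr(2)[of \<eta>] assms by (intro divide_left_mono) (auto intro!: mult_pos_pos two_powr_neg_less_one)
    ultimately have "c * 2 powr (d - \<eta>) * (r powr \<eta> / (1 - 2 powr (- \<eta>))) \<le> 2 / (1 + \<alpha>) * 2 powr d * (r powr \<eta> / (\<eta> / 4))"
      using assms c one_minus_two_powr(2)[of \<eta>] by (intro mult_mono) auto
    also have "\<dots> = 2 / (1 + \<alpha>) * (4 * 2 powr d) * r powr \<eta> / \<eta>" by simp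
    also have "4 * 2 powr d = (2 powr (4 + \<alpha>) :: real)"
      using powr_add[of "2::real" 2 d] by (simp add: d_def)
    finally show "c * 2 powr (d - \<eta>) * (r powr \<eta> / (1 - 2 powr (- \<eta>))) \<le> 2 / (1 + \<alpha>) * 2 powr (4 + \<alpha>) * r powr \<eta> / \<eta>" .
  qed
  finally show "I \<le> ennreal (2 / (1 + \<alpha>) * 2 powr (4 + \<alpha>) * r powr \<eta> / \<eta>)" .
  have "ennreal (2 / (1 + \<alpha>) * (1 - 2 powr (- (2 + \<alpha>))) * r powr \<eta> / \<eta>) \<le> ennreal (c * (r powr \<eta> / (1 - 2 powr (- \<eta>))))"
  proof (rule ennreal_leI)
    have "r powr \<eta> / \<eta> \<le> r powr \<eta> / (1 - 2 powr (- \<eta>))"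
      using one_minus_two_powr(1)[of \<eta>] two_powr_neg_less_one[of \<eta>] assms by (intro divide_left_mono mult_pos_pos) auto
    then have "c * (r powr \<eta> / \<eta>) \<le> c * (r powr \<eta> / (1 - 2 powr (- \<eta>)))" using c by (intro mult_left_mono)
    then show "2 / (1 + \<alpha>) * (1 - 2 powr (- (2 + \<alpha>))) * r powr \<eta> / \<eta> \<le> c * (r powr \<eta> / (1 - 2 powr (- \<eta>)))"
      by (simp add: c_def d_def)
  qed
  also have "\<dots> = (\<Sum>k. ennreal (c * (r / 2 ^ k) powr \<eta>))"
    using c assms by (intro suminf_ennreal_eq[symmetric] sums_mult geometric_powr_sums) auto
  also have "\<dots> = (\<Sum>k. ennreal ((r / 2 ^ k) powr (\<eta> - d)) * emeasure (hm \<alpha>) (shell r k))"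
  proof (intro suminf_cong)
    fix k
    have e: "(r / 2 ^ k) powr \<eta> = (r / 2 ^ k) powr (\<eta> - d) * (r / 2 ^ k) powr d"
      by (simp add: powr_add[symmetric])
    have "(r / 2 ^ k) powr (\<eta> - d) * (c * (r / 2 ^ k) powr d) = c * (r / 2 ^ k) powr \<eta>"
      by (simp only: e ac_simps)
    then show "ennreal (c * (r / 2 ^ k) powr \<eta>) = ennreal ((r / 2 ^ k) powr (\<eta> - d)) * emeasure (hm \<alpha>) (shell r k)"
      using assms c unfolding emeasure_hm_shell[OF assms(1,2)] c_def[symmetric] d_def[symmetric]
      by (subst ennreal_mult[symmetric]) auto
  qed
  also have "\<dots> \<le> I"
    unfolding I_eq
  proof (intro suminf_le allI)
    fix k
    have "(\<integral>\<^sup>+z. ennreal ((r / 2 ^ k) powr (\<eta> - d)) * indicator (shell r k) z \<partial>hm \<alpha>)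
      \<le> (\<integral>\<^sup>+z\<in>shell r k. ennreal (box_gauge z powr (\<eta> - d)) \<partial>hm \<alpha>)"
    proof (intro nn_integral_mono)
      fix z
      show "ennreal ((r / 2 ^ k) powr (\<eta> - d)) * indicator (shell r k) z \<le> ennreal (box_gauge z powr (\<eta> - d)) * indicator (shell r k) z"
      proof (cases "z \<in> shell r k")
        case True
        then have "0 < box_gauge z" by (auto simp: shell_def gauge_box_def gauge_pos)
        then show ?thesis using shell_bounds[OF True] assms d True
          by (auto intro!: ennreal_leI powr_mono2')
      qed simp
    qed
    then show "ennreal ((r / 2 ^ k) powr (\<eta> - d)) * emeasure (hm \<alpha>) (shell r k)
       \<le> (\<integral>\<^sup>+z\<in>shell r k. ennreal (box_gauge z powr (\<eta> - d)) \<partial>hm \<alpha>)"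
      by (simp add: nn_integral_cmult_indicator)
  qed auto
  finally show "ennreal (2 / (1 + \<alpha>) * (1 - 2 powr (- (2 + \<alpha>))) * r powr \<eta> / \<eta>) \<le> I" .
qed

lemma wint_const: "wint \<alpha> (Qbox a b) (\<lambda>_. c) = c * Qmeas \<alpha> a b"
proof -
  have "wint \<alpha> (Qbox a b) (\<lambda>_. c) = (\<integral>\<^sup>+z. c * (indicator (Qbox a b) z * ennreal (Im z powr \<alpha>) * 1) \<partial>lborel)"
    unfolding wint_def by (intro nn_integral_cong) (simp add: ac_simps)
  also have "\<dots> = c * Qmeas \<alpha> a b"
    unfolding Qmeas_def wint_def by (rule nn_integral_cmult) measurable
  finally show ?thesis .
qed

lemma wint_mono: "(\<And>z. z \<in> A \<Longrightarrow> g z \<le> h z) \<Longrightarrow> wint \<alpha> A g \<le> wint \<alpha> A h"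
  unfolding wint_def by (intro nn_integral_mono) (auto intro!: mult_left_mono split: split_indicator)

lemma wint_const_div:
  assumes "-1 < \<alpha>" "a < b"
  shows "wint \<alpha> (Qbox a b) (\<lambda>_. c) / Qmeas \<alpha> a b = c"
  using assms unfolding wint_const by (subst mult_divide_eq_ennreal) (auto simp: Qmeas_eq)

lemma average_le:
  assumes "-1 < \<alpha>" "a < b" "\<And>z. z \<in> Qbox a b \<Longrightarrow> g z \<le> c"
  shows "wint \<alpha> (Qbox a b) g / Qmeas \<alpha> a b \<le> c"
  using divide_right_mono_ennreal[OF wint_mono[of "Qbox a b" g "\<lambda>_. c" \<alpha>]] assms
  by (metis wint_const_div)

lemma average_ge:
  assumes "-1 < \<alpha>" "a < b" "\<And>z. z \<in> Qbox a b \<Longrightarrow> c \<le> g z"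
  shows "c \<le> wint \<alpha> (Qbox a b) g / Qmeas \<alpha> a b"
  using divide_right_mono_ennreal[OF wint_mono[of "Qbox a b" "\<lambda>_. c" g \<alpha>]] assms
  by (metis wint_const_div)

section \<open>The extremal weights and functions\<close>

context off_diagonal
begin

text \<open>The dual weight \<omega>^(-p') = |z|^(\<delta> - (2 + \<alpha>)) is only just integrable
  at the origin, with integral of order 1 / \<delta>. This alone makes the characteristic
  grow.\<close>

definition "test_weight \<delta> z = box_gauge z powr ((2 + \<alpha> - \<delta>) / p')"

text \<open>This is s = \<omega>^(-p') cut to the unit gauge box, the extremal choice in the duality
  of \<omega> f and s: there (\<omega> f)^p = s, because p - p p' = -p'.\<close>

definition "test_fun \<delta> z = complex_of_real (indicator (gauge_box 1) z * box_gauge z powr (\<delta> - (2 + \<alpha>)))"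

lemma test_fun_measurable [measurable]: "test_fun \<delta> \<in> borel_measurable borel"
  unfolding test_fun_def by measurable

lemma test_weight_pos: "z \<in> UH \<Longrightarrow> 0 < test_weight \<delta> z"
  using gauge_pos[of z] by (simp add: test_weight_def)

lemma test_weight_weight: "weight (test_weight \<delta>)"
  unfolding weight_def set_integrable_def
proof (intro conjI ballI allI impI)
  show "0 \<le> test_weight \<delta> z" for z by (simp add: test_weight_def)
  fix K :: "complex set" assume K: "compact K \<and> K \<subseteq> UH"
  have "continuous_on K (test_weight \<delta>)"
    unfolding test_weight_def
  proof (intro continuous_on_powr continuous_on_const ballI)
    show "continuous_on K box_gauge" unfolding box_gauge_def by (intro continuous_intros)
    show "box_gauge z \<noteq> 0" if "z \<in> K" for z using gauge_pos[of z] that K by auto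
  qed
  then show "integrable lborel (\<lambda>z. indicator K z *\<^sub>R test_weight \<delta> z)"
    using K by (intro borel_integrable_compact) auto
qed

lemma enpow_test_weight:
  "z \<in> UH \<Longrightarrow> enpow (ennreal (test_weight \<delta> z)) s = ennreal (box_gauge z powr ((2 + \<alpha> - \<delta>) / p' * s))"
  using test_weight_pos[of z \<delta>] by (subst enpow_ennreal) (auto simp: test_weight_def powr_powr)

lemma test_weight_exponents: "(2 + \<alpha> - \<delta>) / p' * q = (2 + \<alpha> - \<delta>) * (q / p')" "(2 + \<alpha> - \<delta>) / p' * (- p') = \<delta> - (2 + \<alpha>)"
  using p'_gt_1 by auto

text \<open>If the base stays at least one side length away from the origin, the gauge varies by a
  factor of at most 2 and the powers in the two averages cancel. Any other box lies in a gauge box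
  of comparable size, where the dual average gains 1 / \<delta> and enters with power q /
  p'.\<close>

lemma Bchar_test_le:
  assumes \<delta>: "0 < \<delta>" "\<delta> \<le> 1"
  shows "Bchar p q \<alpha> (test_weight \<delta>) \<le> ennreal (2 powr ((4 + 2 * (2 + \<alpha>)) * (q / p')) * \<delta> powr (- (q / p')))"
  unfolding Bchar_def
proof (rule SUP_least, clarify, unfold fst_conv snd_conv p'_def[symmetric])
  fix a b :: real assume ab: "a < b"
  define L where "L = b - a"
  define e where "e = q / p'"
  define d where "d = 2 + \<alpha>"
  have L: "0 < L" and e: "0 < e" and d: "1 < d"
    using ab q_pos p'_gt_1 alpha by (auto simp: L_def e_def d_def)
  define X where "X = wint \<alpha> (Qbox a b) (\<lambda>z. enpow (ennreal (test_weight \<delta> z)) q) / Qmeas \<alpha> a b"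
  define Y where "Y = wint \<alpha> (Qbox a b) (\<lambda>z. enpow (ennreal (test_weight \<delta> z)) (- p')) / Qmeas \<alpha> a b"
  have UH: "z \<in> UH" if "z \<in> Qbox a b" for z using that Qbox_subset_UH by auto
  have X: "X \<le> ennreal (M powr ((d - \<delta>) * e))" if "\<And>z. z \<in> Qbox a b \<Longrightarrow> box_gauge z \<le> M" for M
    unfolding X_def
  proof (rule average_le[OF alpha ab])
    fix z assume z: "z \<in> Qbox a b"
    show "enpow (ennreal (test_weight \<delta> z)) q \<le> ennreal (M powr ((d - \<delta>) * e))"
      unfolding enpow_test_weight[OF UH[OF z]] test_weight_exponents
      unfolding e_def[symmetric] d_def[symmetric]
      using that[OF z] \<delta> d e by (intro ennreal_leI powr_mono2) auto
  qed
  have bound: "2 powr ((d - \<delta>) * e) * (2 powr ((4 + d) * e) * \<delta> powr (- e)) \<le> 2 powr ((4 + 2 * d) * e) * \<delta> powr (- e)"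
  proof -
    have "2 powr ((d - \<delta>) * e) * 2 powr ((4 + d) * e) = (2::real) powr ((4 + 2 * d - \<delta>) * e)"
      by (simp add: powr_add[symmetric] algebra_simps)
    also have "\<dots> \<le> 2 powr ((4 + 2 * d) * e)" using \<delta> e by (intro powr_mono) auto
    finally show ?thesis by (simp add: mult.assoc[symmetric] mult_right_mono)
  qed
  show "X * enpow Y (q / p') \<le> ennreal (2 powr ((4 + 2 * (2 + \<alpha>)) * (q / p')) * \<delta> powr (- (q / p')))"
    unfolding e_def[symmetric] d_def[symmetric]
  proof (cases "L \<le> a \<or> b \<le> - L")
    case True
    \<comment> \<open>The distance from the origin to the base; the far end of the base is at most 2
      m away.\<close>
    define m where "m = (if L \<le> a then a else - b)"
    have m: "L \<le> m" using True by (auto simp: m_def)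
    have g: "m \<le> box_gauge z" "box_gauge z \<le> 2 * m" if "z \<in> Qbox a b" for z
      using that m True L unfolding m_def Qbox_def box_gauge_def L_def by (auto split: if_splits)
    have "Y \<le> ennreal (m powr (\<delta> - d))"
      unfolding Y_def
    proof (rule average_le[OF alpha ab])
      fix z assume z: "z \<in> Qbox a b"
      show "enpow (ennreal (test_weight \<delta> z)) (- p') \<le> ennreal (m powr (\<delta> - d))"
        unfolding enpow_test_weight[OF UH[OF z]] test_weight_exponents
        unfolding d_def[symmetric]
        using g[OF z] \<delta> d m L by (intro ennreal_leI powr_mono2') auto
    qed
    then have "X * enpow Y e \<le> ennreal ((2 * m) powr ((d - \<delta>) * e)) * enpow (ennreal (m powr (\<delta> - d))) e"
      using X[of "2 * m"] g e by (intro mult_mono enpow_mono) auto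
    also have "\<dots> = ennreal ((2 * m) powr ((d - \<delta>) * e) * m powr ((\<delta> - d) * e))"
      using e m L by (subst enpow_ennreal) (auto simp: powr_powr ennreal_mult)
    also have "(2 * m) powr ((d - \<delta>) * e) * m powr ((\<delta> - d) * e) = 2 powr ((d - \<delta>) * e)"
    proof -
      have "m powr ((d - \<delta>) * e) * m powr ((\<delta> - d) * e) = m powr 0"
        unfolding powr_add[symmetric] by (simp add: algebra_simps)
      then show ?thesis using m L by (simp add: powr_mult)
    qed
    also have "ennreal (2 powr ((d - \<delta>) * e)) \<le> ennreal (2 powr ((4 + 2 * d) * e) * \<delta> powr (- e))"
    proof (rule ennreal_leI)
      have "1 \<le> (2::real) powr ((4 + d) * e)" using d e by (intro ge_one_powr_ge_zero) auto
      moreover have "1 \<le> \<delta> powr (- e)" using powr_mono2'[of "- e" \<delta> 1] \<delta> e by simp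
      ultimately have "1 * 1 \<le> 2 powr ((4 + d) * e) * \<delta> powr (- e)" by (intro mult_mono) auto
      then have "2 powr ((d - \<delta>) * e) * 1 \<le> 2 powr ((d - \<delta>) * e) * (2 powr ((4 + d) * e) * \<delta> powr (- e))"
        by (intro mult_left_mono) auto
      from order_trans[OF this bound]
      show "2 powr ((d - \<delta>) * e) \<le> 2 powr ((4 + 2 * d) * e) * \<delta> powr (- e)"
        by (simp only: mult_1_right)
    qed
    finally show "X * enpow Y e \<le> ennreal (2 powr ((4 + 2 * d) * e) * \<delta> powr (- e))" .
  next
    case False
    \<comment> \<open>Here a < L and b > -L, so b = a + L < 2 L and a = b - L > -2 L.\<close>
    have sub: "Qbox a b \<subseteq> gauge_box (2 * L)"
      using False by (auto simp: Qbox_def gauge_box_eq L_def)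
    have X': "X \<le> ennreal ((2 * L) powr ((d - \<delta>) * e))"
      using sub by (intro X) (auto simp: gauge_box_def)
    have "wint \<alpha> (Qbox a b) (\<lambda>z. enpow (ennreal (test_weight \<delta> z)) (- p'))
        = wint \<alpha> (Qbox a b) (\<lambda>z. ennreal (box_gauge z powr (\<delta> - (2 + \<alpha>))))"
      by (intro antisym wint_mono) (simp_all only: UH enpow_test_weight test_weight_exponents order_refl)
    also have "\<dots> = (\<integral>\<^sup>+z\<in>Qbox a b. ennreal (box_gauge z powr (\<delta> - (2 + \<alpha>))) \<partial>hm \<alpha>)"
      by (rule wint_eq_nn_integral_hm) (auto simp: Qbox_subset_UH)
    also have "\<dots> \<le> (\<integral>\<^sup>+z\<in>gauge_box (2 * L). ennreal (box_gauge z powr (\<delta> - (2 + \<alpha>))) \<partial>hm \<alpha>)"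
      using sub by (intro nn_integral_mono) (auto split: split_indicator)
    also have "\<dots> \<le> ennreal (2 / (1 + \<alpha>) * 2 powr (4 + \<alpha>) * (2 * L) powr \<delta> / \<delta>)"
      using L by (intro gauge_integral_le alpha \<delta>) auto
    finally have "Y \<le> ennreal (2 / (1 + \<alpha>) * 2 powr (4 + \<alpha>) * (2 * L) powr \<delta> / \<delta>) / Qmeas \<alpha> a b"
      unfolding Y_def by (rule divide_right_mono_ennreal)
    also have "\<dots> = ennreal (2 / (1 + \<alpha>) * 2 powr (4 + \<alpha>) * (2 * L) powr \<delta> / \<delta> / (L powr d / (1 + \<alpha>)))"
      using alpha \<delta> L unfolding Qmeas_eq[OF alpha ab] L_def[symmetric] d_def[symmetric]
      by (subst divide_ennreal) auto
    also have "\<dots> \<le> ennreal (2 powr (4 + d) * L powr (\<delta> - d) * \<delta> powr (- 1))"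
    proof (rule ennreal_leI)
      \<comment> \<open>Since \<delta> \<le> 1, 2^\<delta> \<le> 2 keeps the constant free of
        \<delta>.\<close>
      have "(2 * L) powr \<delta> \<le> 2 * L powr \<delta>"
        using powr_mono[of \<delta> 1 2] \<delta> L by (simp add: powr_mult mult_right_mono)
      then have "2 / (1 + \<alpha>) * 2 powr (4 + \<alpha>) * (2 * L) powr \<delta> / \<delta> / (L powr d / (1 + \<alpha>))
        \<le> 2 / (1 + \<alpha>) * 2 powr (4 + \<alpha>) * (2 * L powr \<delta>) / \<delta> / (L powr d / (1 + \<alpha>))"
        using alpha \<delta> L by (intro divide_right_mono mult_left_mono) auto
      also have "\<dots> = 4 * 2 powr (4 + \<alpha>) * (L powr \<delta> / L powr d) * (1 / \<delta>)"
        using alpha by (simp add: mult_ac)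
      also have "\<dots> = 2 powr (4 + d) * L powr (\<delta> - d) * \<delta> powr (- 1)"
      proof -
        have "4 * 2 powr (4 + \<alpha>) = (2::real) powr (4 + d)"
          using powr_add[of "2::real" 2 "4 + \<alpha>"] by (simp add: d_def algebra_simps)
        then show ?thesis using \<delta> by (simp add: powr_diff powr_minus_divide)
      qed
      finally show "2 / (1 + \<alpha>) * 2 powr (4 + \<alpha>) * (2 * L) powr \<delta> / \<delta> / (L powr d / (1 + \<alpha>))
        \<le> 2 powr (4 + d) * L powr (\<delta> - d) * \<delta> powr (- 1)" .
    qed
    finally have "X * enpow Y e \<le> ennreal ((2 * L) powr ((d - \<delta>) * e)) * enpow (ennreal (2 powr (4 + d) * L powr (\<delta> - d) * \<delta> powr (- 1))) e"
      using X' e by (intro mult_mono enpow_mono) auto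
    also have "\<dots> = ennreal ((2 * L) powr ((d - \<delta>) * e)) * ennreal ((2 powr (4 + d) * L powr (\<delta> - d) * \<delta> powr (- 1)) powr e)"
      using e by (subst enpow_ennreal) auto
    also have "\<dots> = ennreal ((2 * L) powr ((d - \<delta>) * e) * (2 powr (4 + d) * L powr (\<delta> - d) * \<delta> powr (- 1)) powr e)"
      by (simp add: ennreal_mult)
    also have "(2 * L) powr ((d - \<delta>) * e) * (2 powr (4 + d) * L powr (\<delta> - d) * \<delta> powr (- 1)) powr e
       = 2 powr ((d - \<delta>) * e) * (2 powr ((4 + d) * e) * \<delta> powr (- e))"
    proof -
      have "L powr ((d - \<delta>) * e) * L powr ((\<delta> - d) * e) = L powr 0"
        unfolding powr_add[symmetric] by (simp add: algebra_simps)
      then have "L powr ((d - \<delta>) * e) * L powr ((\<delta> - d) * e) = 1" using L by simp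
      then have "x * L powr ((d - \<delta>) * e) * (y * L powr ((\<delta> - d) * e) * z) = x * (y * z)" for x y z
        by (metis (no_types, opaque_lifting) mult.assoc mult.commute mult_1)
      moreover have "- 1 * e = - e" by simp
      ultimately show ?thesis by (simp only: powr_mult powr_powr)
    qed
    also have "ennreal \<dots> \<le> ennreal (2 powr ((4 + 2 * d) * e) * \<delta> powr (- e))"
      by (intro ennreal_leI bound)
    finally show "X * enpow Y e \<le> ennreal (2 powr ((4 + 2 * d) * e) * \<delta> powr (- e))" .
  qed
qed

text \<open>Serves negative exponents s, for which the power of the characteristic is controlled
  only if the characteristic stays away from 0. Over [1, 2] the gauge lies between 1 and 2, whatever
  \<delta> is.\<close>

lemma Bchar_test_ge:
  assumes \<delta>: "0 < \<delta>" "\<delta> \<le> 1"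
  shows "ennreal (2 powr (- (2 + \<alpha>) * (q / p'))) \<le> Bchar p q \<alpha> (test_weight \<delta>)"
proof -
  have e: "0 < q / p'" using q_pos p'_gt_1 by simp
  have g: "1 \<le> box_gauge z" "box_gauge z \<le> 2" "z \<in> UH" if "z \<in> Qbox 1 2" for z
    using that by (auto simp: Qbox_def box_gauge_def UH_def)
  define X where "X = wint \<alpha> (Qbox 1 2) (\<lambda>z. enpow (ennreal (test_weight \<delta> z)) q) / Qmeas \<alpha> 1 2"
  define Y where "Y = wint \<alpha> (Qbox 1 2) (\<lambda>z. enpow (ennreal (test_weight \<delta> z)) (- p')) / Qmeas \<alpha> 1 2"
  have X: "1 \<le> X" unfolding X_def
  proof (rule average_ge[OF alpha])
    fix z assume z: "z \<in> Qbox 1 2"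
    have "1 \<le> box_gauge z powr ((2 + \<alpha> - \<delta>) * (q / p'))"
      using g[OF z] \<delta> alpha e by (intro ge_one_powr_ge_zero mult_nonneg_nonneg) auto
    then show "1 \<le> enpow (ennreal (test_weight \<delta> z)) q"
      by (simp only: enpow_test_weight[OF g(3)[OF z]] test_weight_exponents ennreal_1[symmetric] ennreal_leI)
  qed simp
  have Y: "ennreal (2 powr (- (2 + \<alpha>))) \<le> Y" unfolding Y_def
  proof (rule average_ge[OF alpha])
    fix z assume z: "z \<in> Qbox 1 2"
    have "2 powr (- (2 + \<alpha>)) \<le> (2::real) powr (\<delta> - (2 + \<alpha>))" using \<delta> by (intro powr_mono) auto
    also have "\<dots> \<le> box_gauge z powr (\<delta> - (2 + \<alpha>))"
      using g[OF z] \<delta> alpha by (intro powr_mono2') auto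
    finally show "ennreal (2 powr (- (2 + \<alpha>))) \<le> enpow (ennreal (test_weight \<delta> z)) (- p')"
      by (simp only: enpow_test_weight[OF g(3)[OF z]] test_weight_exponents ennreal_leI)
  qed simp
  have "ennreal (2 powr (- (2 + \<alpha>) * (q / p'))) = 1 * enpow (ennreal (2 powr (- (2 + \<alpha>)))) (q / p')"
    by (subst enpow_ennreal) (auto simp: powr_powr)
  also have "\<dots> \<le> X * enpow Y (q / p')" using X Y e by (intro mult_mono enpow_mono) auto
  also have "\<dots> \<le> Bchar p q \<alpha> (test_weight \<delta>)" unfolding X_def Y_def by (rule Bchar_ge) simp
  finally show ?thesis .
qed

lemma Lnorm_test_fun_le:
  assumes \<delta>: "0 < \<delta>" "\<delta> \<le> 1"
  shows "Lnorm p \<alpha> (\<lambda>z. ennreal (test_weight \<delta> z * norm (test_fun \<delta> z)))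
    \<le> ennreal ((2 / (1 + \<alpha>) * 2 powr (4 + \<alpha>) / \<delta>) powr (1 / p))"
proof -
  have "enpow (ennreal (test_weight \<delta> z * norm (test_fun \<delta> z))) p
     = ennreal (box_gauge z powr (\<delta> - (2 + \<alpha>))) * indicator (gauge_box 1) z" for z
  proof (cases "z \<in> gauge_box 1")
    case True
    then have g: "0 < box_gauge z" using gauge_box_subset_UH gauge_pos by blast
    have "(x / p' + - x) * p = x * (p / p' - p)" for x by (simp add: algebra_simps)
    from this[of "2 + \<alpha> - \<delta>"]
    have "((2 + \<alpha> - \<delta>) / p' + (\<delta> - (2 + \<alpha>))) * p = (2 + \<alpha> - \<delta>) * (p / p' - p)" by simp
    also have "\<dots> = \<delta> - (2 + \<alpha>)" by (simp add: p'_div)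
    finally have "(box_gauge z powr ((2 + \<alpha> - \<delta>) / p') * box_gauge z powr (\<delta> - (2 + \<alpha>))) powr p = box_gauge z powr (\<delta> - (2 + \<alpha>))"
      unfolding powr_add[symmetric] powr_powr by simp
    then show ?thesis using True g p by (simp add: test_weight_def test_fun_def enpow_ennreal)
  qed (use p in \<open>simp add: test_fun_def\<close>)
  then have "wint \<alpha> UH (\<lambda>z. enpow (ennreal (test_weight \<delta> z * norm (test_fun \<delta> z))) p)
      = (\<integral>\<^sup>+z\<in>gauge_box 1. ennreal (box_gauge z powr (\<delta> - (2 + \<alpha>))) \<partial>hm \<alpha>)"
    by (subst nn_integral_hm) auto
  also have "\<dots> \<le> ennreal (2 / (1 + \<alpha>) * 2 powr (4 + \<alpha>) * 1 powr \<delta> / \<delta>)"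
    by (intro gauge_integral_le alpha \<delta>) auto
  finally have "Lnorm p \<alpha> (\<lambda>z. ennreal (test_weight \<delta> z * norm (test_fun \<delta> z)))
      \<le> enpow (ennreal (2 / (1 + \<alpha>) * 2 powr (4 + \<alpha>) / \<delta>)) (1 / p)"
    unfolding Lnorm_def using p by (intro enpow_mono) auto
  also have "\<dots> = ennreal ((2 / (1 + \<alpha>) * 2 powr (4 + \<alpha>) / \<delta>) powr (1 / p))"
    using alpha \<delta> by (intro enpow_ennreal) auto
  finally show ?thesis .
qed

definition "shell_const = 2 / (1 + \<alpha>) * (1 - 2 powr (- (2 + \<alpha>)))"

lemma shell_const_pos: "0 < shell_const"
  using two_powr_neg_less_one[of "2 + \<alpha>"] alpha by (simp add: shell_const_def)

text \<open>Test the interval [-r, r] with r = |z|: its box contains the gauge box of radius r,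
  where the integral of f is at least of order r^\<delta> / \<delta>.\<close>

lemma maxop_test_fun_ge:
  assumes \<delta>: "0 < \<delta>" "\<delta> \<le> 1" and z: "z \<in> gauge_box 1"
  shows "ennreal (2 powr (- (2 + \<alpha> - \<gamma>)) * shell_const / \<delta> * box_gauge z powr (\<delta> - (2 + \<alpha> - \<gamma>))) \<le> maxop \<alpha> \<gamma> (test_fun \<delta>) z"
proof -
  define r where "r = box_gauge z"
  have r: "0 < r" "r < 1" using z gauge_pos by (auto simp: gauge_box_def r_def)
  \<comment> \<open>z is on the boundary of the gauge box of radius r, but inside
    \<open>Qbox\<close>, whose base is closed and whose height is 2 r.\<close>
  have zQ: "z \<in> Qbox (- r) r"
    using z r by (auto simp: r_def gauge_box_eq Qbox_def box_gauge_def max_def)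
  have sub: "gauge_box r \<subseteq> Qbox (- r) r" "gauge_box r \<subseteq> gauge_box 1"
    using r by (auto simp: gauge_box_eq Qbox_def)
  have "ennreal (shell_const * r powr \<delta> / \<delta>) \<le> (\<integral>\<^sup>+z\<in>gauge_box r. ennreal (box_gauge z powr (\<delta> - (2 + \<alpha>))) \<partial>hm \<alpha>)"
    unfolding shell_const_def by (intro gauge_integral_ge alpha \<delta> r)
  also have "\<dots> \<le> (\<integral>\<^sup>+z\<in>Qbox (- r) r. ennreal (norm (test_fun \<delta> z)) \<partial>hm \<alpha>)"
    using sub by (intro nn_integral_mono) (auto simp: test_fun_def split: split_indicator)
  also have "\<dots> = wint \<alpha> (Qbox (- r) r) (\<lambda>z. ennreal (norm (test_fun \<delta> z)))"
    by (rule wint_eq_nn_integral_hm[symmetric]) (auto simp: Qbox_subset_UH)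
  finally have "ennreal ((r - (- r)) powr (- (2 + \<alpha> - \<gamma>))) * ennreal (shell_const * r powr \<delta> / \<delta>)
    \<le> ennreal ((r - (- r)) powr (- (2 + \<alpha> - \<gamma>))) * wint \<alpha> (Qbox (- r) r) (\<lambda>z. ennreal (norm (test_fun \<delta> z)))"
    by (intro mult_left_mono) auto
  also have "\<dots> \<le> maxop \<alpha> \<gamma> (test_fun \<delta>) z"
    unfolding maxop_def by (rule SUP_upper2[of "(- r, r)"]) (use r zQ in auto)
  also have "ennreal ((r - (- r)) powr (- (2 + \<alpha> - \<gamma>))) * ennreal (shell_const * r powr \<delta> / \<delta>)
      = ennreal (2 powr (- (2 + \<alpha> - \<gamma>)) * shell_const / \<delta> * r powr (\<delta> - (2 + \<alpha> - \<gamma>)))"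
  proof -
    have 1: "(r - (- r)) powr (- (2 + \<alpha> - \<gamma>)) = 2 powr (- (2 + \<alpha> - \<gamma>)) * r powr (- (2 + \<alpha> - \<gamma>))"
      using powr_mult[of 2 r "- (2 + \<alpha> - \<gamma>)"] by simp
    have 2: "r powr (\<delta> - (2 + \<alpha> - \<gamma>)) = r powr (- (2 + \<alpha> - \<gamma>)) * r powr \<delta>"
    proof -
      have "\<delta> - (2 + \<alpha> - \<gamma>) = - (2 + \<alpha> - \<gamma>) + \<delta>" by simp
      then show ?thesis by (simp only: powr_add)
    qed
    show ?thesis unfolding 1 2 using shell_const_pos \<delta> by (subst ennreal_mult[symmetric]) auto
  qed
  finally show ?thesis by (simp add: r_def)
qed

text \<open>The q-th power of the lower bound is a multiple of |z|^(\<eta> - (2 + \<alpha>)) with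
  \<eta> = q \<delta> / p. One factor 1 / \<delta> comes from the maximal function, a further
  \<delta>^(-1 / q) from integrating this power.\<close>

lemma Lnorm_maxop_test_fun_ge:
  assumes \<delta>: "0 < \<delta>" "\<delta> \<le> 1" "q * \<delta> / p \<le> 1"
  shows "ennreal (2 powr (- (2 + \<alpha> - \<gamma>)) * shell_const / \<delta> * (shell_const / (q * \<delta> / p)) powr (1 / q))
    \<le> Lnorm q \<alpha> (\<lambda>z. ennreal (test_weight \<delta> z) * maxop \<alpha> \<gamma> (test_fun \<delta>) z)"
proof -
  define c where "c = 2 powr (- (2 + \<alpha> - \<gamma>)) * shell_const / \<delta>"
  have c: "0 < c" using shell_const_pos \<delta> by (simp add: c_def)
  define \<eta> where "\<eta> = q * \<delta> / p"
  have \<eta>: "0 < \<eta>" "\<eta> \<le> 1" using \<delta> q_pos p by (auto simp: \<eta>_def)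
  have "ennreal (c powr q) * ennreal (shell_const / \<eta>) \<le> ennreal (c powr q) * (\<integral>\<^sup>+z\<in>gauge_box 1. ennreal (box_gauge z powr (\<eta> - (2 + \<alpha>))) \<partial>hm \<alpha>)"
    using gauge_integral_ge[OF alpha _ \<eta>, of 1] by (intro mult_left_mono) (auto simp: shell_const_def)
  also have "\<dots> = (\<integral>\<^sup>+z. ennreal (c powr q) * (ennreal (box_gauge z powr (\<eta> - (2 + \<alpha>))) * indicator (gauge_box 1) z) \<partial>hm \<alpha>)"
    by (subst nn_integral_cmult) auto
  also have "\<dots> = wint \<alpha> UH (\<lambda>z. ennreal (c powr q) * (ennreal (box_gauge z powr (\<eta> - (2 + \<alpha>))) * indicator (gauge_box 1) z))"
    by (rule nn_integral_hm) measurable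
  also have "\<dots> \<le> wint \<alpha> UH (\<lambda>z. enpow (ennreal (test_weight \<delta> z) * maxop \<alpha> \<gamma> (test_fun \<delta>) z) q)"
  proof (rule wint_mono)
    fix z
    show "ennreal (c powr q) * (ennreal (box_gauge z powr (\<eta> - (2 + \<alpha>))) * indicator (gauge_box 1) z)
        \<le> enpow (ennreal (test_weight \<delta> z) * maxop \<alpha> \<gamma> (test_fun \<delta>) z) q"
    proof (cases "z \<in> gauge_box 1")
      case True
      then have g: "0 < box_gauge z" using gauge_box_subset_UH gauge_pos by blast
      have "x / p' = x - x / p" for x
        using arg_cong[OF inverse_p', of "\<lambda>y. x * y"] by (simp add: right_diff_distrib)
      then have "((2 + \<alpha> - \<delta>) / p' + (\<delta> - (2 + \<alpha> - \<gamma>))) * q = q * (\<gamma> - (2 + \<alpha>) / p) + q * \<delta> / p"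
        by (simp add: diff_divide_distrib add_divide_distrib algebra_simps)
      also have "\<gamma> - (2 + \<alpha>) / p = - (2 + \<alpha>) * (1 / q)"
      proof -
        have *: "\<gamma> - x / p = - x * (1 / p - \<gamma> / x)" if "x \<noteq> 0" for x
          using that by (simp add: right_diff_distrib)
        have "2 + \<alpha> \<noteq> 0" using alpha by simp
        from *[OF this] show ?thesis unfolding q_eq .
      qed
      also have "q * (- (2 + \<alpha>) * (1 / q)) + q * \<delta> / p = \<eta> - (2 + \<alpha>)"
        using q_pos by (simp add: \<eta>_def)
      finally have e: "((2 + \<alpha> - \<delta>) / p' + (\<delta> - (2 + \<alpha> - \<gamma>))) * q = \<eta> - (2 + \<alpha>)" .
      have "c powr q * box_gauge z powr (\<eta> - (2 + \<alpha>)) = (test_weight \<delta> z * (c * box_gauge z powr (\<delta> - (2 + \<alpha> - \<gamma>)))) powr q"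
        unfolding test_weight_def e[symmetric] powr_powr[symmetric] powr_add by (simp only: powr_mult ac_simps)
      then have "ennreal (c powr q) * (ennreal (box_gauge z powr (\<eta> - (2 + \<alpha>))) * indicator (gauge_box 1) z)
         = enpow (ennreal (test_weight \<delta> z * (c * box_gauge z powr (\<delta> - (2 + \<alpha> - \<gamma>))))) q"
        using True c q_pos
        by (subst enpow_ennreal) (auto simp: ennreal_mult'[symmetric] test_weight_def)
      also have "\<dots> \<le> enpow (ennreal (test_weight \<delta> z) * maxop \<alpha> \<gamma> (test_fun \<delta>) z) q"
      proof (intro enpow_mono q_pos)
        have "ennreal (test_weight \<delta> z * (c * box_gauge z powr (\<delta> - (2 + \<alpha> - \<gamma>)))) = ennreal (test_weight \<delta> z) * ennreal (c * box_gauge z powr (\<delta> - (2 + \<alpha> - \<gamma>)))"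
          using c by (intro ennreal_mult) (auto simp: test_weight_def)
        also have "\<dots> \<le> ennreal (test_weight \<delta> z) * maxop \<alpha> \<gamma> (test_fun \<delta>) z"
          unfolding c_def by (intro mult_left_mono maxop_test_fun_ge \<delta> True) auto
        finally show "ennreal (test_weight \<delta> z * (c * box_gauge z powr (\<delta> - (2 + \<alpha> - \<gamma>)))) \<le> ennreal (test_weight \<delta> z) * maxop \<alpha> \<gamma> (test_fun \<delta>) z" .
      qed
      finally show ?thesis .
    qed simp
  qed
  finally have "enpow (ennreal (c powr q) * ennreal (shell_const / \<eta>)) (1 / q)
    \<le> Lnorm q \<alpha> (\<lambda>z. ennreal (test_weight \<delta> z) * maxop \<alpha> \<gamma> (test_fun \<delta>) z)"
    unfolding Lnorm_def using q_pos by (intro enpow_mono) auto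
  moreover have "enpow (ennreal (c powr q) * ennreal (shell_const / \<eta>)) (1 / q) = ennreal (c * (shell_const / \<eta>) powr (1 / q))"
    using q_pos c \<eta> shell_const_pos by (simp add: enpow_mult enpow_ennreal powr_powr ennreal_mult)
  ultimately show ?thesis by (simp add: c_def \<eta>_def)
qed

text \<open>On the test pair the assumed inequality bounds \<delta>^(-\<epsilon>) by a constant for
  all small \<delta>, where \<epsilon> > 0 is the gap between the rates of the two sides.\<close>

theorem exponent_sharp:
  assumes s: "s < \<kappa>"
    and bound: "\<And>\<omega> f. weight \<omega> \<Longrightarrow> Bchar p q \<alpha> \<omega> < top \<Longrightarrow> f \<in> borel_measurable borel \<Longrightarrow>
      Lnorm q \<alpha> (\<lambda>z. ennreal (\<omega> z) * maxop \<alpha> \<gamma> f z)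
        \<le> ennreal C * enpow (Bchar p q \<alpha> \<omega>) s * Lnorm p \<alpha> (\<lambda>z. ennreal (\<omega> z * norm (f z)))"
  shows False
proof -
  define e where "e = q / p'"
  have e: "0 < e" using q_pos p'_gt_1 by (simp add: e_def)
  \<comment> \<open>For negative s the power of the characteristic is merely bounded, by b0^s, which
    is rate 0 in \<delta>. M adds the constants of both signs.\<close>
  define t where "t = max s 0"
  define b0 b1 :: real where "b0 = 2 powr (- (2 + \<alpha>) * e)" and "b1 = 2 powr ((4 + 2 * (2 + \<alpha>)) * e)"
  define M where "M = b1 powr t + b0 powr s"
  define K where "K = 2 / (1 + \<alpha>) * 2 powr (4 + \<alpha>)"
  define A where "A = 2 powr (- (2 + \<alpha> - \<gamma>)) * shell_const * (shell_const * p / q) powr (1 / q)"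
  define R where "R = max C 0 * M * K powr (1 / p)"
  \<comment> \<open>Equal to 1 + 1 / q - (e t + 1 / p), because 1 / q = 1 / p - \<theta>.\<close>
  define \<epsilon> where "\<epsilon> = 1 - \<theta> - e * t"
  have A: "0 < A" and R: "0 \<le> R"
    using shell_const_pos p q_pos by (auto simp: A_def R_def M_def)
  have \<epsilon>: "0 < \<epsilon>"
  proof -
    have "e * t < e * \<kappa>" using s kappa_pos e by (simp add: t_def)
    then show ?thesis using kappa_mult by (simp add: \<epsilon>_def e_def mult.commute)
  qed
  have key: "\<delta> powr (- \<epsilon>) \<le> R / A" if \<delta>: "0 < \<delta>" "\<delta> \<le> 1" "q * \<delta> / p \<le> 1" for \<delta>
  proof -
    have B_le: "Bchar p q \<alpha> (test_weight \<delta>) \<le> ennreal (b1 * \<delta> powr (- e))"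
      using Bchar_test_le[OF \<delta>(1,2)] by (simp add: b1_def e_def)
    then obtain b where b: "Bchar p q \<alpha> (test_weight \<delta>) = ennreal b" "0 \<le> b"
      by (cases "Bchar p q \<alpha> (test_weight \<delta>)") (auto simp: top_unique)
    have b_ge: "b0 \<le> b" using Bchar_test_ge[OF \<delta>(1,2)] b by (simp add: b0_def e_def)
    have b_le: "b \<le> b1 * \<delta> powr (- e)" using B_le b by (simp add: ennreal_le_iff b1_def)
    have b0: "0 < b0" by (simp add: b0_def)
    have "b powr s \<le> M * \<delta> powr (- (e * t))"
    proof (cases "0 \<le> s")
      case True
      then have "b powr s \<le> (b1 * \<delta> powr (- e)) powr t" using b b_le by (auto simp: t_def intro: powr_mono2)
      also have "\<dots> = b1 powr t * \<delta> powr (- (e * t))" by (simp add: powr_mult powr_powr)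
      also have "\<dots> \<le> M * \<delta> powr (- (e * t))" by (intro mult_right_mono) (auto simp: M_def)
      finally show ?thesis .
    next
      case False
      then have "b powr s \<le> b0 powr s" using b0 b_ge by (intro powr_mono2') auto
      then show ?thesis using False \<delta> by (simp add: M_def t_def add_increasing)
    qed
    then have E: "enpow (Bchar p q \<alpha> (test_weight \<delta>)) s \<le> ennreal (M * \<delta> powr (- (e * t)))"
      using b b0 b_ge by (simp add: enpow_ennreal ennreal_leI)
    have "ennreal (2 powr (- (2 + \<alpha> - \<gamma>)) * shell_const / \<delta> * (shell_const / (q * \<delta> / p)) powr (1 / q))
      \<le> Lnorm q \<alpha> (\<lambda>z. ennreal (test_weight \<delta> z) * maxop \<alpha> \<gamma> (test_fun \<delta>) z)"
      by (rule Lnorm_maxop_test_fun_ge[OF \<delta>])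
    also have "\<dots> \<le> ennreal C * enpow (Bchar p q \<alpha> (test_weight \<delta>)) s * Lnorm p \<alpha> (\<lambda>z. ennreal (test_weight \<delta> z * norm (test_fun \<delta> z)))"
      using b by (intro bound test_weight_weight) auto
    \<comment> \<open>\<open>ennreal\<close> sends a negative C to 0, hence the maximum.\<close>
    also have "\<dots> \<le> ennreal (max C 0) * ennreal (M * \<delta> powr (- (e * t))) * ennreal ((K / \<delta>) powr (1 / p))"
      using E Lnorm_test_fun_le[OF \<delta>(1,2)] unfolding K_def by (intro mult_mono ennreal_leI) auto
    also have "\<dots> = ennreal (max C 0 * (M * \<delta> powr (- (e * t))) * (K / \<delta>) powr (1 / p))"
      by (simp add: ennreal_mult M_def)
    finally have le: "2 powr (- (2 + \<alpha> - \<gamma>)) * shell_const / \<delta> * (shell_const / (q * \<delta> / p)) powr (1 / q)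
        \<le> max C 0 * (M * \<delta> powr (- (e * t))) * (K / \<delta>) powr (1 / p)"
      by (subst (asm) ennreal_le_iff) (auto simp: M_def)
    have left: "2 powr (- (2 + \<alpha> - \<gamma>)) * shell_const / \<delta> * (shell_const / (q * \<delta> / p)) powr (1 / q) = A * (\<delta> powr (- 1) * \<delta> powr (- (1 / q)))"
    proof -
      have "shell_const / (q * \<delta> / p) = (shell_const * p / q) * inverse \<delta>" by (simp add: divide_inverse)
      then have "(shell_const / (q * \<delta> / p)) powr (1 / q) = (shell_const * p / q) powr (1 / q) * \<delta> powr (- (1 / q))"
        by (simp only: powr_mult inverse_powr powr_minus)
      then show ?thesis using \<delta> by (simp add: A_def powr_minus_divide)
    qed
    have right: "max C 0 * (M * \<delta> powr (- (e * t))) * (K / \<delta>) powr (1 / p) = R * (\<delta> powr (- (e * t)) * \<delta> powr (- (1 / p)))"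
    proof -
      have "(K / \<delta>) powr (1 / p) = K powr (1 / p) * \<delta> powr (- (1 / p))"
        by (simp only: divide_inverse powr_mult inverse_powr powr_minus)
      then show ?thesis by (simp add: R_def)
    qed
    have le: "A * \<delta> powr (- 1 - 1 / q) \<le> R * \<delta> powr (- (e * t) - 1 / p)"
      using le unfolding left right powr_add[symmetric] by simp
    have "A * \<delta> powr (- 1 - 1 / q) * \<delta> powr (e * t + 1 / p) \<le> R * \<delta> powr (- (e * t) - 1 / p) * \<delta> powr (e * t + 1 / p)"
      by (intro mult_right_mono le) auto
    then have "A * \<delta> powr (- 1 - 1 / q + (e * t + 1 / p)) \<le> R * \<delta> powr 0"
      by (simp add: mult.assoc powr_add[symmetric])
    moreover have "- 1 - 1 / q + (e * t + 1 / p) = - \<epsilon>" using inverse_q by (simp add: \<epsilon>_def)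
    ultimately have "A * \<delta> powr (- \<epsilon>) \<le> R" using \<delta> by simp
    then show ?thesis using A by (simp add: pos_le_divide_eq mult.commute)
  qed
  \<comment> \<open>The third entry makes \<delta>^(-\<epsilon>) at least R / A + 1; the second
    ensures q \<delta> / p \<le> 1.\<close>
  define \<delta> where "\<delta> = Min {1, p / q, (R / A + 1) powr (- (1 / \<epsilon>))}"
  have RA: "0 < R / A + 1" using A R by (simp add: add_nonneg_pos)
  have \<delta>: "0 < \<delta>" "\<delta> \<le> 1" "\<delta> \<le> p / q" "\<delta> \<le> (R / A + 1) powr (- (1 / \<epsilon>))"
    using RA p q_pos by (auto simp: \<delta>_def)
  have "q * \<delta> / p \<le> 1" using \<delta>(3) p q_pos by (simp add: field_simps)
  then have "\<delta> powr (- \<epsilon>) \<le> R / A" using key \<delta> by blast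
  moreover have "((R / A + 1) powr (- (1 / \<epsilon>))) powr (- \<epsilon>) \<le> \<delta> powr (- \<epsilon>)"
    using \<delta> \<epsilon> by (intro powr_mono2') auto
  moreover have "((R / A + 1) powr (- (1 / \<epsilon>))) powr (- \<epsilon>) = R / A + 1"
    using \<epsilon> RA by (simp add: powr_powr)
  ultimately show False by simp
qed

end

theorem theorem2p11:
  fixes \<alpha> \<gamma> p q :: real
  assumes "\<alpha> > -1" and "0 \<le> \<gamma>" and "\<gamma> < 2 + \<alpha>"
    and "1 < p" and "\<gamma> = 0 \<or> p < (2 + \<alpha>) / \<gamma>"
    and "1 / q = 1 / p - \<gamma> / (2 + \<alpha>)"
  shows "(\<exists>C::real. C > 0 \<and>
            (\<forall>\<omega> f. weight \<omega> \<and> Bchar p q \<alpha> \<omega> < top \<and> f \<in> borel_measurable lborel \<longrightarrow>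
               Lnorm q \<alpha> (\<lambda>z. ennreal (\<omega> z) * maxop \<alpha> \<gamma> f z)
                 \<le> ennreal C * enpow (Bchar p q \<alpha> \<omega>) (conj_exp p / q * (1 - \<gamma> / (2 + \<alpha>)))
                   * Lnorm p \<alpha> (\<lambda>z. ennreal (\<omega> z * norm (f z)))))
       \<and> (\<forall>s::real. s < conj_exp p / q * (1 - \<gamma> / (2 + \<alpha>)) \<longrightarrow>
            \<not> (\<exists>C'::real. \<forall>\<omega> f. weight \<omega> \<and> Bchar p q \<alpha> \<omega> < top \<and> f \<in> borel_measurable lborel \<longrightarrow>
               Lnorm q \<alpha> (\<lambda>z. ennreal (\<omega> z) * maxop \<alpha> \<gamma> f z)
                 \<le> ennreal C' * enpow (Bchar p q \<alpha> \<omega>) s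
                   * Lnorm p \<alpha> (\<lambda>z. ennreal (\<omega> z * norm (f z)))))"
proof -
  interpret off_diagonal \<alpha> \<gamma> p q by unfold_locales fact+
  have k: "conj_exp p / q * (1 - \<gamma> / (2 + \<alpha>)) = \<kappa>"
    by (simp add: \<kappa>_def p'_def \<theta>_def)
  show ?thesis unfolding k
  proof (intro conjI allI impI notI)
    show "\<exists>C::real. C > 0 \<and> (\<forall>\<omega> f. weight \<omega> \<and> Bchar p q \<alpha> \<omega> < top \<and> f \<in> borel_measurable lborel \<longrightarrow>
        Lnorm q \<alpha> (\<lambda>z. ennreal (\<omega> z) * maxop \<alpha> \<gamma> f z)
          \<le> ennreal C * enpow (Bchar p q \<alpha> \<omega>) \<kappa> * Lnorm p \<alpha> (\<lambda>z. ennreal (\<omega> z * norm (f z))))"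
      using strong_const_pos maximal_bound by (intro exI[of _ strong_const]) simp
    fix s :: real
    assume "s < \<kappa>" and "\<exists>C'::real. \<forall>\<omega> f. weight \<omega> \<and> Bchar p q \<alpha> \<omega> < top \<and> f \<in> borel_measurable lborel \<longrightarrow>
        Lnorm q \<alpha> (\<lambda>z. ennreal (\<omega> z) * maxop \<alpha> \<gamma> f z)
          \<le> ennreal C' * enpow (Bchar p q \<alpha> \<omega>) s * Lnorm p \<alpha> (\<lambda>z. ennreal (\<omega> z * norm (f z)))"
    then show False using exponent_sharp[of s] by fastforce
  qed
qed

end
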